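(* Let $N\ge 1$ be an integer and consider an aligned chain of $N$ mixed bipartite two-qubit states $\hat\rho_{01},\hat\rho_{12},\dots,\hat\rho_{N-1\,N}$, where for $k=1,\dots,N$ the state $\hat\rho_{k-1\,k}$ is shared between party $k-1$ and party $k$, each of these two parties holding one of its two qubits. Suppose the $N+1$ parties $0,1,\dots,N$ perform LOCC on the initial state $\hat\rho_{01}\otimes\hat\rho_{12}\otimes\cdots\otimes\hat\rho_{N-1\,N}$, with the resultant distribution of two-qubit states between party $0$ and party $N$ denoted by $\{P_j,\hat\sigma_{0N}^j\}$, where $P_j$ is the probability of obtaining the state $\hat\sigma_{0N}^j$. Then $$C_{0N}\equiv\sum_jP_j\,C(\hat\sigma_{0N}^j)\;\le\;C_{01}\,C_{12}\cdots C_{N-1\,N},$$ where $C_{k-1\,k}\equiv C(\hat\rho_{k-1\,k})$ for $k=1,\dots,N$ and $C$ denotes the concurrence.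
   Context: A state is a density operator (positive semidefinite, trace one); a qubit has Hilbert space $\mathbb{C}^2$. Parties $0$ and $N$ each hold one qubit; each intermediate party $1,\dots,N-1$ holds two qubits, one from each of the two neighbouring states in the chain. Concurrence: for a normalized pure bipartite state $|\psi\rangle$, $C(|\psi\rangle)=\sqrt{2(1-\mathrm{Tr}\,\hat\rho_r^2)}$, where $\hat\rho_r$ is obtained from $|\psi\rangle\langle\psi|$ by partial trace over one of the two shares. For a mixed bipartite state $\hat\rho$, $C(\hat\rho)=\min\sum_i p_iC(|\psi_i\rangle)$, the minimum being over all decompositions $\hat\rho=\sum_ip_i|\psi_i\rangle\langle\psi_i|$ into normalized pure states with probabilities $p_i$. LOCC (local operations and classical communication among all parties): a finite sequence of rounds. In each round one party performs a generalized measurement on the systems it holds (possibly including local ancillas), described by Kraus operators $\hat M^{(i)}$ with $\sum_i\hat M^{(i)\dagger}\hat M^{(i)}=I$; the choice of measurement may depend on all earlier results, and the result $i$ is communicated to the other parties. The outcome label $j$ records the measurement results, and $\hat\sigma_{0N}^j$ is the normalized final state given outcome $j$, reduced by partial trace to the qubits of parties $0$ and $N$. *)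

theory Defs
  imports Complex_Main "Jordan_Normal_Form.Schur_Decomposition"
begin

definition mat_trace :: "complex mat \<Rightarrow> complex" where
  "mat_trace A = (\<Sum>i<dim_row A. A $$ (i, i))"

definition mat_sum :: "nat \<Rightarrow> complex mat list \<Rightarrow> complex mat" where
  "mat_sum n As = foldr (+) As (0\<^sub>m n n)"

definition kron :: "complex mat \<Rightarrow> complex mat \<Rightarrow> complex mat" (infixr \<open>\<otimes>\<^sub>m\<close> 72) where
  "A \<otimes>\<^sub>m B = mat (dim_row A * dim_row B) (dim_col A * dim_col B)
     (\<lambda>(i, j). A $$ (i div dim_row B, j div dim_col B) * B $$ (i mod dim_row B, j mod dim_col B))"

(* Trace over the middle factor of C^l (x) C^m (x) C^r; the basis index of |a>|k>|b> is
   (a * m + k) * r + b, and (i div r, i mod r) are the coordinates (a, b) of the result. *)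
definition partial_trace :: "nat \<Rightarrow> nat \<Rightarrow> nat \<Rightarrow> complex mat \<Rightarrow> complex mat" where
  "partial_trace l m r A = mat (l * r) (l * r)
     (\<lambda>(i, j). \<Sum>k<m. A $$ ((i div r * m + k) * r + i mod r, (j div r * m + k) * r + j mod r))"

(* Over the complex numbers, 0 \<le> z also says that z is real, so this includes Hermiticity. *)
definition density_operator :: "nat \<Rightarrow> complex mat \<Rightarrow> bool" where
  "density_operator n A \<longleftrightarrow> A \<in> carrier_mat n n \<and>
     (\<forall>v \<in> carrier_vec n. 0 \<le> (A *\<^sub>v v) \<bullet>c v) \<and> mat_trace A = 1"

definition ket_bra :: "complex vec \<Rightarrow> complex mat" where
  "ket_bra v = mat (dim_vec v) (dim_vec v) (\<lambda>(i, j). v $ i * cnj (v $ j))"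

definition pure_state :: "nat \<Rightarrow> complex vec \<Rightarrow> bool" where
  "pure_state n v \<longleftrightarrow> v \<in> carrier_vec n \<and> v \<bullet>c v = 1"

definition pure_concurrence :: "complex vec \<Rightarrow> real" where
  "pure_concurrence v =
     (let r = partial_trace 2 2 1 (ket_bra v) in sqrt (2 * (1 - Re (mat_trace (r * r)))))"

definition pure_decomposition :: "complex mat \<Rightarrow> (real \<times> complex vec) list \<Rightarrow> bool" where
  "pure_decomposition A D \<longleftrightarrow>
     (\<forall>(p, v) \<in> set D. 0 \<le> p \<and> pure_state 4 v) \<and> (\<Sum>(p, v)\<leftarrow>D. p) = 1 \<and>
     A = mat_sum 4 (map (\<lambda>(p, v). complex_of_real p \<cdot>\<^sub>m ket_bra v) D)"

(* For a two-qubit state the infimum is attained, so that this is the minimum of the average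
   concurrence over all decompositions. *)
definition concurrence :: "complex mat \<Rightarrow> real" where
  "concurrence A = Inf {\<Sum>(p, v)\<leftarrow>D. p * pure_concurrence v | D. pure_decomposition A D}"

(* \<rho> k is the state shared by the parties k - 1 and k. The qubits of the tensor product are in
   the order in which the parties 0, ..., N hold them: one for party 0, two for each of the
   parties 1, ..., N - 1 and one for party N. *)
definition chain_state :: "nat \<Rightarrow> (nat \<Rightarrow> complex mat) \<Rightarrow> complex mat" where
  "chain_state N \<rho> = foldr (\<otimes>\<^sub>m) (map \<rho> [1..<Suc N]) (1\<^sub>m 1)"

definition qubit_dim :: "nat \<Rightarrow> nat \<Rightarrow> nat" where
  "qubit_dim N p = (if p = 0 \<or> p = N then 2 else 4)"

(* An adaptive protocol as a finite tree: in Measure p bs, party p performs the measurement with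
   the Kraus operators map fst bs and, after the result M, the protocol continues with the
   subtree paired with M. *)
datatype locc = Stop | Measure nat "(complex mat \<times> locc) list"

(* d p is the current dimension of the space of party p, namely the dimension of its qubits times
   that of its ancillas. Kraus operators may be rectangular: an operator M on qubits and a fresh
   ancilla in the state |t> is the operator M (1 (x) |t>) on the qubits. *)
fun valid_locc :: "nat \<Rightarrow> (nat \<Rightarrow> nat) \<Rightarrow> locc \<Rightarrow> bool" where
  "valid_locc N d Stop \<longleftrightarrow> True"
| "valid_locc N d (Measure p bs) \<longleftrightarrow> p \<le> N \<and>
     mat_sum (d p) (map (\<lambda>(M, Q). mat_adjoint M * M) bs) = 1\<^sub>m (d p) \<and>
     (\<forall>(M, Q) \<in> set bs. (\<exists>a > 0. M \<in> carrier_mat (qubit_dim N p * a) (d p)) \<and>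
        valid_locc N (d(p := dim_row M)) Q)"

definition locc_protocol :: "nat \<Rightarrow> locc \<Rightarrow> bool" where
  "locc_protocol N Q \<longleftrightarrow> valid_locc N (qubit_dim N) Q"

definition local_op :: "nat \<Rightarrow> (nat \<Rightarrow> nat) \<Rightarrow> nat \<Rightarrow> complex mat \<Rightarrow> complex mat" where
  "local_op N d p M = 1\<^sub>m (\<Prod>q<p. d q) \<otimes>\<^sub>m M \<otimes>\<^sub>m 1\<^sub>m (\<Prod>q\<in>{p<..N}. d q)"

(* The unnormalized final states K A K^dagger, one for each sequence of measurement results. *)
fun locc_outcomes :: "nat \<Rightarrow> (nat \<Rightarrow> nat) \<Rightarrow> complex mat \<Rightarrow> locc \<Rightarrow> complex mat list" where
  "locc_outcomes N d A Stop = [A]"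
| "locc_outcomes N d A (Measure p bs) = concat (map (\<lambda>(M, Q).
     locc_outcomes N (d(p := dim_row M)) (local_op N d p M * A * mat_adjoint (local_op N d p M)) Q) bs)"

(* The qubit of party 0 is the first tensor factor and that of party N the last one (the ancillas
   of party 0 follow its qubit, those of party N precede its qubit), so everything in between is
   traced out. An outcome of probability 0 carries a zero matrix instead of a state. *)
definition locc_distribution :: "nat \<Rightarrow> complex mat \<Rightarrow> locc \<Rightarrow> (real \<times> complex mat) list" where
  "locc_distribution N A Q =
     map (\<lambda>B. (Re (mat_trace B), (1 / mat_trace B) \<cdot>\<^sub>m partial_trace 2 (dim_row B div 4) 2 B))
       (locc_outcomes N (qubit_dim N) A Q)"

end

theory Submission
  imports Defs
begin

text \<open>Every outcome of a protocol has a Kraus operator \<open>K = F\<^sub>0 \<otimes> \<dots> \<otimes> F\<^sub>N\<close>, and measurements preserve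
  the sum over the outcomes of \<open>\<Prod>q. \<parallel>F\<^sub>q\<parallel>\<^sup>2\<close> (Frobenius norm), which is initially the dimension \<open>4\<^sup>N\<close>.
  Decompose each \<open>\<rho> k\<close> almost optimally into unnormalized pure states, regarded as 2 by 2 matrices
  \<open>\<psi>\<^sub>k\<close>; the concurrence of such a state is \<open>2 \<bar>det \<psi>\<^sub>k\<bar>\<close>. Fixing a basis vector of everything that
  is traced out, the outcome of \<open>\<psi>\<^sub>1 \<otimes> \<dots> \<otimes> \<psi>\<^sub>N\<close> becomes a vector of the two end qubits whose 2 by 2
  matrix is a product \<open>A\<^sub>0 \<psi>\<^sub>1 A\<^sub>1 \<psi>\<^sub>2 \<dots> \<psi>\<^sub>N A\<^sub>N\<close>, where \<open>A\<^sub>q\<close> is made of entries of \<open>F\<^sub>q\<close>.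
  These vectors decompose the reduced outcome; the determinant is multiplicative, and
  \<open>\<bar>det A\<bar> \<le> \<parallel>A\<parallel>\<^sup>2 / 2\<close> bounds the sum over all basis vectors and outcomes by
  \<open>2 \<cdot> 4\<^sup>N / 2\<^sup>N\<^sup>+\<^sup>1 \<cdot> \<Prod>k. \<bar>det \<psi>\<^sub>k\<bar> = \<Prod>k. 2 \<bar>det \<psi>\<^sub>k\<bar>\<close>.\<close>

section \<open>Mixed-radix index arithmetic and adjoints\<close>

lemma mult_add_less:
  fixes i j m n :: nat
  assumes "i < m" "j < n"
  shows "i * n + j < m * n"
proof -
  have "i * n + j < Suc i * n" using assms by simp
  also have "\<dots> \<le> m * n" using assms by (intro mult_le_mono1) simp
  finally show ?thesis .
qed

text \<open>A basis index of a tensor product is \<open>i * n + j\<close>; this identity, read in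
  either direction, regroups sums over such indices. At \<open>n = 0\<close> both sums are
  empty.\<close>

lemma sum_div_mod:
  fixes f :: "nat \<Rightarrow> nat \<Rightarrow> 'a::comm_monoid_add"
  shows "(\<Sum>x<m * n. f (x div n) (x mod n)) = (\<Sum>i<m. \<Sum>j<n. f i j)"
proof (cases "n = 0")
  case False
  have "(\<Sum>i<m. \<Sum>j<n. f i j) = (\<Sum>(i, j)\<in>{..<m} \<times> {..<n}. f i j)"
    by (rule sum.cartesian_product)
  also have "\<dots> = (\<Sum>x<m * n. f (x div n) (x mod n))"
  proof (rule sum.reindex_bij_witness[of _ "\<lambda>x. (x div n, x mod n)" "\<lambda>(i, j). i * n + j"], goal_cases)
    case (2 p)
    then show ?case by (auto intro: mult_add_less)
  next
    case (4 x)
    with False show ?case by (simp add: less_mult_imp_div_less)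
  qed (use False in \<open>auto simp: less_mult_imp_div_less\<close>)
  finally show ?thesis ..
qed simp

lemma dim_mat_adjoint [simp]:
  "dim_row (mat_adjoint A) = dim_col A" "dim_col (mat_adjoint A) = dim_row A"
  by (simp_all add: mat_adjoint_def)

lemma index_mat_adjoint [simp]:
  "i < dim_col A \<Longrightarrow> j < dim_row A \<Longrightarrow> mat_adjoint A $$ (i, j) = cnj (A $$ (j, i))"
  by (simp add: mat_adjoint_def mat_of_rows_def)

lemma mat_adjoint_mult:
  fixes A B :: "complex mat"
  assumes "dim_col A = dim_row B"
  shows "mat_adjoint (A * B) = mat_adjoint B * mat_adjoint A"
  by (rule eq_matI) (use assms in \<open>auto simp: scalar_prod_def mult.commute intro!: sum.cong\<close>)

section \<open>Kronecker products\<close>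

lemma dim_kron [simp]:
  "dim_row (A \<otimes>\<^sub>m B) = dim_row A * dim_row B" "dim_col (A \<otimes>\<^sub>m B) = dim_col A * dim_col B"
  by (simp_all add: kron_def)

lemma index_kron:
  "i < dim_row A * dim_row B \<Longrightarrow> j < dim_col A * dim_col B \<Longrightarrow>
    (A \<otimes>\<^sub>m B) $$ (i, j) = A $$ (i div dim_row B, j div dim_col B) * B $$ (i mod dim_row B, j mod dim_col B)"
  by (simp add: kron_def)

lemma div_mod_less_mult:
  fixes i m n :: nat
  assumes "i < m * n"
  shows "i div n < m" "i mod n < n"
  using assms by (auto simp: less_mult_imp_div_less intro!: mod_less_divisor gr0I)

lemma kron_assoc: "(A \<otimes>\<^sub>m B) \<otimes>\<^sub>m C = A \<otimes>\<^sub>m (B \<otimes>\<^sub>m C)"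
proof (rule eq_matI)
  have split: "x div n div m = x div (m * n)" "x div n mod m = x mod (m * n) div n"
    "x mod (m * n) mod n = x mod n" for x m n :: nat
    by (cases "n = 0"; simp add: div_mult2_eq mult.commute[of m n] mod_mult2_eq)+
  fix i j
  assume "i < dim_row (A \<otimes>\<^sub>m (B \<otimes>\<^sub>m C))" "j < dim_col (A \<otimes>\<^sub>m (B \<otimes>\<^sub>m C))"
  then have i: "i < dim_row A * (dim_row B * dim_row C)" "i < dim_row A * dim_row B * dim_row C"
    and j: "j < dim_col A * (dim_col B * dim_col C)" "j < dim_col A * dim_col B * dim_col C"
    by (auto simp: mult.assoc)
  show "((A \<otimes>\<^sub>m B) \<otimes>\<^sub>m C) $$ (i, j) = (A \<otimes>\<^sub>m (B \<otimes>\<^sub>m C)) $$ (i, j)"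
    using i j div_mod_less_mult[OF i(1)] div_mod_less_mult[OF j(1)]
      div_mod_less_mult[OF i(2)] div_mod_less_mult[OF j(2)]
    by (simp add: index_kron split mult.assoc)
qed (simp_all add: mult.assoc)

lemma kron_one: "1\<^sub>m a \<otimes>\<^sub>m 1\<^sub>m b = 1\<^sub>m (a * b)"
proof (rule eq_matI)
  fix i j assume ij: "i < dim_row (1\<^sub>m (a * b) :: complex mat)" "j < dim_col (1\<^sub>m (a * b) :: complex mat)"
  have "i = j" if "i div b = j div b" "i mod b = j mod b"
    using that by (metis div_mult_mod_eq)
  with ij show "(1\<^sub>m a \<otimes>\<^sub>m 1\<^sub>m b) $$ (i, j) = 1\<^sub>m (a * b) $$ (i, j)"
    using div_mod_less_mult[of i a b] div_mod_less_mult[of j a b] by (auto simp: index_kron)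
qed simp_all

lemma kron_one_left [simp]: "1\<^sub>m 1 \<otimes>\<^sub>m A = A"
  by (rule eq_matI) (auto simp: index_kron)

lemma kron_one_right [simp]: "A \<otimes>\<^sub>m 1\<^sub>m 1 = A"
  by (rule eq_matI) (auto simp: index_kron)

lemma kron_mult:
  assumes "dim_col A = dim_row C" "dim_col B = dim_row D"
  shows "(A \<otimes>\<^sub>m B) * (C \<otimes>\<^sub>m D) = (A * C) \<otimes>\<^sub>m (B * D)"
proof (rule eq_matI)
  fix i j
  assume "i < dim_row ((A * C) \<otimes>\<^sub>m (B * D))" "j < dim_col ((A * C) \<otimes>\<^sub>m (B * D))"
  then have i: "i < dim_row A * dim_row B" and j: "j < dim_col C * dim_col D"
    by auto
  note bounds = div_mod_less_mult[OF i] div_mod_less_mult[OF j]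
  define f where "f x y = A $$ (i div dim_row B, x) * B $$ (i mod dim_row B, y) *
    (C $$ (x, j div dim_col D) * D $$ (y, j mod dim_col D))" for x y
  have "((A \<otimes>\<^sub>m B) * (C \<otimes>\<^sub>m D)) $$ (i, j)
      = (\<Sum>x<dim_row C * dim_row D. f (x div dim_row D) (x mod dim_row D))"
    using i j assms by (auto simp: scalar_prod_def index_kron atLeast0LessThan f_def intro!: sum.cong)
  also have "\<dots> = (\<Sum>x<dim_row C. \<Sum>y<dim_row D. f x y)"
    by (rule sum_div_mod)
  also have "\<dots> = ((A * C) \<otimes>\<^sub>m (B * D)) $$ (i, j)"
    using i j bounds assms
    by (simp add: index_kron scalar_prod_def atLeast0LessThan sum_product f_def mult_ac)
  finally show "((A \<otimes>\<^sub>m B) * (C \<otimes>\<^sub>m D)) $$ (i, j) = ((A * C) \<otimes>\<^sub>m (B * D)) $$ (i, j)" .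
qed simp_all

text \<open>The same right-nested fold as in \<open>chain_state\<close>, so that states and products
  of local operators are treated by one set of lemmas.\<close>

definition kron_list :: "complex mat list \<Rightarrow> complex mat" where
  "kron_list As = foldr (\<otimes>\<^sub>m) As (1\<^sub>m 1)"

lemma kron_list_simps [simp]:
  "kron_list [] = 1\<^sub>m 1" "kron_list (A # As) = A \<otimes>\<^sub>m kron_list As"
  by (simp_all add: kron_list_def)

lemma kron_list_append: "kron_list (As @ Bs) = kron_list As \<otimes>\<^sub>m kron_list Bs"
  by (induction As) (simp_all add: kron_assoc del: One_nat_def)

lemma dim_kron_list:
  "dim_row (kron_list As) = prod_list (map dim_row As)"
  "dim_col (kron_list As) = prod_list (map dim_col As)"
  by (induction As) simp_all

lemma kron_list_one: "kron_list (map (\<lambda>x. 1\<^sub>m (d x)) xs) = 1\<^sub>m (prod_list (map d xs))"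
  by (induction xs) (simp_all add: kron_one)

lemma kron_list_mult:
  assumes "\<forall>x\<in>set xs. dim_col (F x) = dim_row (G x)"
  shows "kron_list (map F xs) * kron_list (map G xs) = kron_list (map (\<lambda>x. F x * G x) xs)"
  using assms
proof (induction xs)
  case (Cons x xs)
  from Cons.prems have "map dim_col (map F xs) = map dim_row (map G xs)"
    by simp
  then have "dim_col (kron_list (map F xs)) = dim_row (kron_list (map G xs))"
    unfolding dim_kron_list by (simp only:)
  with Cons show ?case by (simp add: kron_mult)
qed simp

text \<open>Padding with one identity per party, instead of two large ones, lets operators of
  different parties be multiplied factor by factor.\<close>

lemma local_op_eq_kron_list:
  assumes "p \<le> N"
  shows "local_op N d p M = kron_list (map (\<lambda>q. if q = p then M else 1\<^sub>m (d q)) [0..<Suc N])"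
proof -
  have split: "[0..<Suc N] = [0..<p] @ p # [Suc p..<Suc N]"
    using assms by (metis le_imp_less_Suc less_imp_le_nat upt_add_eq_append le_add_diff_inverse
        upt_conv_Cons zero_le)
  have "kron_list (map (\<lambda>q. if q = p then M else 1\<^sub>m (d q)) [0..<p]) = 1\<^sub>m (\<Prod>q<p. d q)"
  proof -
    have "(\<Prod>q<p. d q) = prod_list (map d [0..<p])"
      using prod.distinct_set_conv_list[of "[0..<p]" d] by (simp add: atLeast0LessThan)
    then show ?thesis
      by (auto simp: kron_list_one[symmetric] intro!: arg_cong[of _ _ kron_list])
  qed
  moreover have "kron_list (map (\<lambda>q. if q = p then M else 1\<^sub>m (d q)) [Suc p..<Suc N])
      = 1\<^sub>m (\<Prod>q\<in>{p<..N}. d q)"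
  proof -
    have "set [Suc p..<Suc N] = {p<..N}" by auto
    then have "(\<Prod>q\<in>{p<..N}. d q) = prod_list (map d [Suc p..<Suc N])"
      using prod.distinct_set_conv_list[of "[Suc p..<Suc N]" d] by (simp del: upt_Suc)
    then show ?thesis
      by (auto simp: kron_list_one[symmetric] simp del: upt_Suc intro!: arg_cong[of _ _ kron_list])
  qed
  ultimately show ?thesis
    unfolding local_op_def split by (simp add: kron_list_append del: upt_Suc)
qed

text \<open>A measurement by party p preserves the product form of the accumulated Kraus operator
  and changes only its factor p.\<close>

lemma local_op_mult_kron_list:
  assumes "p \<le> N" "dim_col M = d p" "\<And>q. q \<le> N \<Longrightarrow> dim_row (F q) = d q"
  shows "local_op N d p M * kron_list (map F [0..<Suc N])
    = kron_list (map (F(p := M * F p)) [0..<Suc N])"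
proof -
  have "1\<^sub>m (d q) * F q = F q" if "q \<le> N" for q
    using assms(3)[OF that] by (intro left_mult_one_mat) auto
  then show ?thesis
    using assms unfolding local_op_eq_kron_list[OF assms(1)]
    by (subst kron_list_mult)
      (auto simp: less_Suc_eq_le simp del: upt_Suc intro!: arg_cong[of _ _ kron_list])
qed

section \<open>The Kraus operators of a protocol\<close>

text \<open>The squared Frobenius norm, that is the trace of A^dagger A.\<close>

definition frob :: "complex mat \<Rightarrow> real" where
  "frob A = (\<Sum>i<dim_row A. \<Sum>j<dim_col A. (cmod (A $$ (i, j)))\<^sup>2)"

lemma frob_nonneg: "0 \<le> frob A"
  by (simp add: frob_def sum_nonneg)

lemma frob_one: "frob (1\<^sub>m n) = n"
proof -
  have "(\<Sum>j<n. (cmod (1\<^sub>m n $$ (i, j)))\<^sup>2) = (\<Sum>j<n. if i = j then 1 else 0)" if "i < n" for i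
    using that by (intro sum.cong) auto
  then show ?thesis by (simp add: frob_def)
qed

lemma mat_sum_simps [simp]:
  "mat_sum n [] = 0\<^sub>m n n" "mat_sum n (A # As) = A + mat_sum n As"
  by (simp_all add: mat_sum_def)

lemma mat_sum_carrier:
  "\<forall>A\<in>set As. A \<in> carrier_mat n n \<Longrightarrow> mat_sum n As \<in> carrier_mat n n"
  by (induction As) auto

lemma index_mat_sum:
  assumes "\<forall>A\<in>set As. A \<in> carrier_mat n n" "i < n" "j < n"
  shows "mat_sum n As $$ (i, j) = (\<Sum>A\<leftarrow>As. A $$ (i, j))"
  using assms(1)
proof (induction As)
  case (Cons A As)
  then show ?case using assms(2,3) mat_sum_carrier[of As n] by auto
qed (use assms in simp)

text \<open>The trace of A^dagger (M^dagger M) A, written out so that it is visibly linear in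
  M^dagger M. The completeness relation can then be summed inside.\<close>

lemma frob_mult:
  fixes A M :: "complex mat"
  assumes "dim_col M = dim_row A"
  shows "complex_of_real (frob (M * A)) = (\<Sum>j<dim_col A. \<Sum>x<dim_row A. \<Sum>y<dim_row A.
    cnj (A $$ (x, j)) * (mat_adjoint M * M) $$ (x, y) * A $$ (y, j))"
proof -
  have swap3: "(\<Sum>i\<in>I. \<Sum>x\<in>X. \<Sum>y\<in>X. f i x y) = (\<Sum>x\<in>X. \<Sum>y\<in>X. \<Sum>i\<in>I. f i x y)"
    for f :: "nat \<Rightarrow> nat \<Rightarrow> nat \<Rightarrow> complex" and I X
    by (subst sum.swap) (rule sum.cong[OF refl sum.swap])
  have "complex_of_real (frob (M * A)) = (\<Sum>j<dim_col A. \<Sum>i<dim_row M.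
      cnj (\<Sum>x<dim_row A. M $$ (i, x) * A $$ (x, j)) * (\<Sum>y<dim_row A. M $$ (i, y) * A $$ (y, j)))"
    unfolding frob_def using assms
    by (subst sum.swap)
      (simp add: scalar_prod_def atLeast0LessThan complex_norm_square mult.commute del: of_real_power)
  also have "\<dots> = (\<Sum>j<dim_col A. \<Sum>i<dim_row M. \<Sum>x<dim_row A. \<Sum>y<dim_row A.
      cnj (A $$ (x, j)) * (cnj (M $$ (i, x)) * M $$ (i, y)) * A $$ (y, j))"
    by (simp add: sum_product) (simp add: mult_ac)
  also have "\<dots> = (\<Sum>j<dim_col A. \<Sum>x<dim_row A. \<Sum>y<dim_row A. \<Sum>i<dim_row M.
      cnj (A $$ (x, j)) * (cnj (M $$ (i, x)) * M $$ (i, y)) * A $$ (y, j))"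
    by (rule sum.cong[OF refl swap3])
  also have "\<dots> = (\<Sum>j<dim_col A. \<Sum>x<dim_row A. \<Sum>y<dim_row A.
      cnj (A $$ (x, j)) * (mat_adjoint M * M) $$ (x, y) * A $$ (y, j))"
    using assms by (simp add: scalar_prod_def atLeast0LessThan sum_distrib_left sum_distrib_right)
  finally show ?thesis .
qed

text \<open>By \<open>frob_mult\<close> the left side depends on the measurement only through the
  sum of the M^dagger M, which is the identity.\<close>

lemma sum_list_frob_mult:
  assumes "mat_sum n (map (\<lambda>M. mat_adjoint M * M) Ms) = 1\<^sub>m n" "dim_row A = n"
    "\<forall>M\<in>set Ms. dim_col M = n"
  shows "(\<Sum>M\<leftarrow>Ms. frob (M * A)) = frob A"
proof -
  have sum: "(\<Sum>M\<leftarrow>Ms. (mat_adjoint M * M) $$ (x, y)) = 1\<^sub>m n $$ (x, y)" if "x < n" "y < n" for x y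
  proof -
    have "\<forall>A\<in>set (map (\<lambda>M. mat_adjoint M * M) Ms). A \<in> carrier_mat n n"
      using assms(3) by auto
    from index_mat_sum[OF this that] show ?thesis
      unfolding assms(1) by (simp add: comp_def)
  qed
  have swap: "(\<Sum>M\<leftarrow>Ms. \<Sum>i\<in>I. f M i) = (\<Sum>i\<in>I. \<Sum>M\<leftarrow>Ms. f M i)"
    for f :: "complex mat \<Rightarrow> nat \<Rightarrow> complex" and I Ms
    by (induction Ms) (simp_all add: sum.distrib)
  have "complex_of_real (\<Sum>M\<leftarrow>Ms. frob (M * A)) = (\<Sum>M\<leftarrow>Ms. complex_of_real (frob (M * A)))"
    by (induction Ms) simp_all
  also have "\<dots> = (\<Sum>M\<leftarrow>Ms. \<Sum>j<dim_col A. \<Sum>x<n. \<Sum>y<n.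
      cnj (A $$ (x, j)) * (mat_adjoint M * M) $$ (x, y) * A $$ (y, j))"
    using assms by (intro arg_cong[of _ _ sum_list] map_cong refl) (simp add: frob_mult)
  also have "\<dots> = (\<Sum>j<dim_col A. \<Sum>x<n. \<Sum>y<n.
      cnj (A $$ (x, j)) * (\<Sum>M\<leftarrow>Ms. (mat_adjoint M * M) $$ (x, y)) * A $$ (y, j))"
    by (simp add: swap sum_list_const_mult sum_list_mult_const)
  also have "\<dots> = (\<Sum>j<dim_col A. \<Sum>x<n. \<Sum>y<n.
      cnj (A $$ (x, j)) * 1\<^sub>m n $$ (x, y) * A $$ (y, j))"
    by (simp add: sum)
  also have "\<dots> = (\<Sum>j<dim_col A. \<Sum>x<n. \<Sum>y<n. if x = y then cnj (A $$ (x, j)) * A $$ (x, j) else 0)"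
    by (intro sum.cong refl) auto
  also have "\<dots> = complex_of_real (frob A)"
    unfolding frob_def using assms
    by (subst sum.swap) (simp add: complex_norm_square mult.commute del: of_real_power)
  finally show ?thesis by (simp only: of_real_eq_iff)
qed

lemma sum_list_map_concat:
  "sum_list (map f (concat xss)) = sum_list (map (\<lambda>xs. sum_list (map f xs)) xss)"
  by (induction xss) simp_all

text \<open>The Kraus operator of a sequence of results is \<open>kron_list (map F [0..<Suc N])\<close> for a family
  \<open>F\<close> of operators of the parties; these are the families of a protocol, started from \<open>F\<close>.\<close>

fun locc_kraus :: "(nat \<Rightarrow> complex mat) \<Rightarrow> locc \<Rightarrow> (nat \<Rightarrow> complex mat) list" where
  "locc_kraus F Stop = [F]"
| "locc_kraus F (Measure p bs) = concat (map (\<lambda>(M, Q). locc_kraus (F(p := M * F p)) Q) bs)"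

text \<open>The induction rule of the nested datatype reaches the subtrees through
  \<open>snds\<close> of the pairs; this form speaks of the branches \<open>(M, Q)\<close>
  directly.\<close>

lemma locc_induct:
  assumes "P Stop" "\<And>p bs. (\<And>M Q. (M, Q) \<in> set bs \<Longrightarrow> P Q) \<Longrightarrow> P (Measure p bs)"
  shows "P Q"
proof (induction Q)
  case (Measure p bs)
  then show ?case by (intro assms(2)) (force simp: snds.simps)
qed (rule assms(1))

lemma conjugate_mult:
  fixes K L X :: "complex mat"
  assumes L: "L \<in> carrier_mat a b" and K: "K \<in> carrier_mat b n" and X: "X \<in> carrier_mat n n"
  shows "L * (K * X * mat_adjoint K) * mat_adjoint L = (L * K) * X * mat_adjoint (L * K)"
proof -
  have K': "mat_adjoint K \<in> carrier_mat n b" and L': "mat_adjoint L \<in> carrier_mat b a"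
    using K L by auto
  note car = K K' L L' X mult_carrier_mat[OF X K'] mult_carrier_mat[OF K' L']
    mult_carrier_mat[OF X mult_carrier_mat[OF K' L']]
  have "L * (K * X * mat_adjoint K) * mat_adjoint L
      = L * (K * (X * (mat_adjoint K * mat_adjoint L)))"
    using assoc_mult_mat[OF K X K'] assoc_mult_mat[OF L mult_carrier_mat[OF K car(6)] L']
      assoc_mult_mat[OF K car(6) L'] assoc_mult_mat[OF X K' L'] by simp
  also have "\<dots> = (L * K) * X * (mat_adjoint K * mat_adjoint L)"
    using assoc_mult_mat[OF L K car(8)] assoc_mult_mat[OF mult_carrier_mat[OF L K] X car(7)] by simp
  also have "mat_adjoint K * mat_adjoint L = mat_adjoint (L * K)"
    using K L by (intro mat_adjoint_mult[symmetric]) auto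
  finally show ?thesis .
qed

text \<open>The initial state \<open>X\<close> stays fixed while the accumulated family
  \<open>F\<close> and the dimensions \<open>d\<close> vary in the induction. Both lists come in the
  same order, so each outcome is matched with its Kraus family.\<close>

lemma locc_outcomes_eq:
  assumes "valid_locc N d Q" "\<And>q. q \<le> N \<Longrightarrow> dim_row (F q) = d q"
    "dim_col (kron_list (map F [0..<Suc N])) = n" "X \<in> carrier_mat n n"
  shows "locc_outcomes N d (kron_list (map F [0..<Suc N]) * X * mat_adjoint (kron_list (map F [0..<Suc N]))) Q
    = map (\<lambda>G. kron_list (map G [0..<Suc N]) * X * mat_adjoint (kron_list (map G [0..<Suc N])))
        (locc_kraus F Q)"
  using assms
proof (induction Q arbitrary: F d rule: locc_induct)
  case (2 p bs)
  let ?K = "\<lambda>F. kron_list (map F [0..<Suc N])"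
  have branch: "locc_outcomes N (d(p := dim_row M))
      (local_op N d p M * (?K F * X * mat_adjoint (?K F)) * mat_adjoint (local_op N d p M)) Q
    = map (\<lambda>G. ?K G * X * mat_adjoint (?K G)) (locc_kraus (F(p := M * F p)) Q)"
    if MQ: "(M, Q) \<in> set bs" for M Q
  proof -
    from MQ 2(2) have M: "dim_col M = d p" "valid_locc N (d(p := dim_row M)) Q" and p: "p \<le> N"
      by auto
    let ?L = "local_op N d p M" and ?F = "F(p := M * F p)"
    have LK: "?L * ?K F = ?K ?F"
      using local_op_mult_kron_list[OF p] M(1) 2(3) by blast
    have row: "dim_row (?K F) = prod_list (map d [0..<Suc N])"
      unfolding dim_kron_list using 2(3)
      by (auto simp: less_Suc_eq_le simp del: upt_Suc intro!: arg_cong[of _ _ prod_list])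
    have col: "dim_col ?L = prod_list (map d [0..<Suc N])"
      unfolding local_op_eq_kron_list[OF p] dim_kron_list using M(1)
      by (auto simp del: upt_Suc intro!: arg_cong[of _ _ prod_list])
    have "?L \<in> carrier_mat (dim_row ?L) (dim_row (?K F))" "?K F \<in> carrier_mat (dim_row (?K F)) n"
      using row col 2(4) by (auto simp del: upt_Suc)
    from conjugate_mult[OF this 2(5)]
    have eq: "?L * (?K F * X * mat_adjoint (?K F)) * mat_adjoint ?L
      = ?K ?F * X * mat_adjoint (?K ?F)"
      unfolding LK .
    have "dim_col (?K ?F) = n"
      using LK 2(4) by (metis index_mult_mat(3))
    moreover have "dim_row (?F q) = (d(p := dim_row M)) q" if "q \<le> N" for q
      using 2(3)[OF that] by simp
    ultimately show ?thesis
      unfolding eq using 2(1)[OF MQ M(2)] 2(5) by blast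
  qed
  show ?case
    unfolding locc_outcomes.simps locc_kraus.simps map_concat map_map
    by (rule arg_cong[of _ _ concat], rule map_cong[OF refl])
      (simp only: split_paired_all comp_apply prod.case branch)
qed simp

text \<open>Measurements multiply on the left, so the input dimensions \<open>e\<close> persist,
  while validity keeps each output dimension a multiple of \<open>qubit_dim\<close>. The latter
  makes it possible to split off the qubits that the end parties keep.\<close>

lemma locc_kraus_carrier:
  assumes "valid_locc N d Q" "\<And>q. q \<le> N \<Longrightarrow> dim_row (F q) = d q \<and> dim_col (F q) = e q"
    "\<And>q. q \<le> N \<Longrightarrow> \<exists>a. d q = qubit_dim N q * a" "G \<in> set (locc_kraus F Q)" "q \<le> N"
  shows "dim_col (G q) = e q \<and> (\<exists>a. dim_row (G q) = qubit_dim N q * a)"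
  using assms
proof (induction Q arbitrary: F d rule: locc_induct)
  case (2 p bs)
  from 2(5) obtain M Q where MQ: "(M, Q) \<in> set bs" "G \<in> set (locc_kraus (F(p := M * F p)) Q)"
    by (auto simp del: fun_upd_apply)
  from 2(2) MQ(1) obtain a where M: "M \<in> carrier_mat (qubit_dim N p * a) (d p)"
    and Q: "valid_locc N (d(p := dim_row M)) Q"
    by auto
  show ?case
    by (rule 2(1)[OF MQ(1) Q _ _ MQ(2) 2(6)]) (use M 2(3,4) in auto)
qed auto

text \<open>The conservation law: a round changes one factor of the product only, and summing that
  factor over the results restores it by \<open>sum_list_frob_mult\<close>.\<close>

lemma sum_list_locc_kraus:
  assumes "valid_locc N d Q" "\<And>q. q \<le> N \<Longrightarrow> dim_row (F q) = d q"
  shows "(\<Sum>G\<leftarrow>locc_kraus F Q. \<Prod>q\<le>N. frob (G q)) = (\<Prod>q\<le>N. frob (F q))"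
  using assms
proof (induction Q arbitrary: F d rule: locc_induct)
  case (2 p bs)
  from 2(2) have p: "p \<le> N"
    and one: "mat_sum (d p) (map (\<lambda>M. mat_adjoint M * M) (map fst bs)) = 1\<^sub>m (d p)"
    by (auto simp: case_prod_unfold comp_def)
  have split: "(\<Prod>q\<le>N. frob ((F(p := Y)) q)) = frob Y * (\<Prod>q\<in>{..N} - {p}. frob (F q))" for Y
    using p by (subst prod.remove[of _ p]) (auto intro!: prod.cong)
  have branch: "(\<Sum>G\<leftarrow>locc_kraus (F(p := M * F p)) Q. \<Prod>q\<le>N. frob (G q))
      = frob (M * F p) * (\<Prod>q\<in>{..N} - {p}. frob (F q))"
    if MQ: "(M, Q) \<in> set bs" for M Q
  proof -
    have valid: "valid_locc N (d(p := dim_row M)) Q" using MQ 2(2) by auto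
    have "dim_row ((F(p := M * F p)) q) = (d(p := dim_row M)) q" if "q \<le> N" for q
      using 2(3)[OF that] by simp
    from 2(1)[OF MQ valid this] show ?thesis by (simp only: split)
  qed
  have "(\<Sum>G\<leftarrow>locc_kraus F (Measure p bs). \<Prod>q\<le>N. frob (G q))
      = (\<Sum>(M, Q)\<leftarrow>bs. frob (M * F p) * (\<Prod>q\<in>{..N} - {p}. frob (F q)))"
    unfolding locc_kraus.simps sum_list_map_concat map_map
    by (rule arg_cong[of _ _ sum_list], rule map_cong[OF refl])
      (simp only: split_paired_all comp_apply prod.case branch)
  also have "\<dots> = (\<Sum>M\<leftarrow>map fst bs. frob (M * F p)) * (\<Prod>q\<in>{..N} - {p}. frob (F q))"
    by (simp add: sum_list_mult_const case_prod_unfold comp_def)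
  also have "(\<Sum>M\<leftarrow>map fst bs. frob (M * F p)) = frob (F p)"
    using one 2(2,3) p by (intro sum_list_frob_mult) auto
  finally show ?case
    using split[of "F p"] by simp
qed simp

section \<open>Amplitudes of a pure chain\<close>

definition det2 :: "(nat \<Rightarrow> nat \<Rightarrow> complex) \<Rightarrow> complex" where
  "det2 f = f 0 0 * f 1 1 - f 0 1 * f 1 0"

lemma det2_cong:
  assumes "\<And>i j. i < 2 \<Longrightarrow> j < 2 \<Longrightarrow> f i j = g i j"
  shows "det2 f = det2 g"
  by (simp add: det2_def assms)

text \<open>The triangle inequality, followed by 2xy \<le> x^2 + y^2 for each of the two
  products.\<close>

lemma cmod_det2_le: "cmod (det2 f) \<le> (\<Sum>i<2. \<Sum>j<2. (cmod (f i j))\<^sup>2) / 2"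
proof -
  have "cmod (det2 f) \<le> cmod (f 0 0) * cmod (f 1 1) + cmod (f 0 1) * cmod (f 1 0)"
    unfolding det2_def by (metis norm_mult norm_triangle_ineq4)
  also have "\<dots> \<le> ((cmod (f 0 0))\<^sup>2 + (cmod (f 1 1))\<^sup>2) / 2 + ((cmod (f 0 1))\<^sup>2 + (cmod (f 1 0))\<^sup>2) / 2"
    using sum_squares_bound[of "cmod (f 0 0)" "cmod (f 1 1)"]
      sum_squares_bound[of "cmod (f 0 1)" "cmod (f 1 0)"] by (simp add: field_simps)
  finally show ?thesis by (simp add: numeral_2_eq_2 field_simps)
qed

text \<open>The case of an intermediate party. For a fixed output \<open>i\<close>, the row is a
  functional on its two input qubits \<open>b\<close> and \<open>c\<close>, hence a 2 by 2
  matrix.\<close>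

lemma sum_cmod_det2_row_le:
  assumes "dim_col A = 4"
  shows "(\<Sum>i<dim_row A. cmod (det2 (\<lambda>b c. A $$ (i, 2 * b + c)))) \<le> frob A / 2"
proof -
  have "(\<Sum>i<dim_row A. cmod (det2 (\<lambda>b c. A $$ (i, 2 * b + c))))
      \<le> (\<Sum>i<dim_row A. (\<Sum>b<2. \<Sum>c<2. (cmod (A $$ (i, 2 * b + c)))\<^sup>2) / 2)"
    by (intro sum_mono cmod_det2_le)
  also have "\<dots> = frob A / 2"
    unfolding frob_def assms sum_divide_distrib[symmetric] by (simp add: eval_nat_numeral add_ac)
  finally show ?thesis .
qed

text \<open>The case of an end party: the matrix leads from its input qubit \<open>c\<close> to the
  qubit \<open>b\<close> that it keeps, for a fixed ancilla index \<open>k\<close>. The kept qubit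
  precedes the ancillas for party 0 (first claim) and follows them for party N (second
  claim).\<close>

lemma sum_cmod_det2_fibre_le:
  assumes "dim_col A = 2" "dim_row A = 2 * a"
  shows "(\<Sum>k<a. cmod (det2 (\<lambda>b c. A $$ (b * a + k, c)))) \<le> frob A / 2"
    and "(\<Sum>k<a. cmod (det2 (\<lambda>b c. A $$ (2 * k + b, c)))) \<le> frob A / 2"
proof -
  have "(\<Sum>k<a. cmod (det2 (\<lambda>b c. A $$ (b * a + k, c))))
      \<le> (\<Sum>k<a. (\<Sum>b<2. \<Sum>c<2. (cmod (A $$ (b * a + k, c)))\<^sup>2) / 2)"
    by (intro sum_mono cmod_det2_le)
  also have "\<dots> = (\<Sum>b<2. \<Sum>k<a. \<Sum>c<2. (cmod (A $$ (b * a + k, c)))\<^sup>2) / 2"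
    by (simp add: sum_divide_distrib[symmetric] sum.swap[of _ "{..<a}" "{..<2}"])
  also have "\<dots> = frob A / 2"
    using sum_div_mod[of "\<lambda>b k. \<Sum>c<2. (cmod (A $$ (b * a + k, c)))\<^sup>2" a 2]
    unfolding frob_def assms by simp
  finally show "(\<Sum>k<a. cmod (det2 (\<lambda>b c. A $$ (b * a + k, c)))) \<le> frob A / 2" .
  have "(\<Sum>k<a. cmod (det2 (\<lambda>b c. A $$ (2 * k + b, c))))
      \<le> (\<Sum>k<a. (\<Sum>b<2. \<Sum>c<2. (cmod (A $$ (k * 2 + b, c)))\<^sup>2) / 2)"
    by (subst mult.commute[of 2]) (intro sum_mono cmod_det2_le)
  also have "\<dots> = frob A / 2"
    using sum_div_mod[of "\<lambda>k b. \<Sum>c<2. (cmod (A $$ (k * 2 + b, c)))\<^sup>2" 2 a]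
    unfolding frob_def assms by (simp add: sum_divide_distrib[symmetric] mult.commute[of a 2])
  finally show "(\<Sum>k<a. cmod (det2 (\<lambda>b c. A $$ (2 * k + b, c)))) \<le> frob A / 2" .
qed

text \<open>The sum is the entry (b, j) of f g h^T. The determinant is multiplicative and invariant
  under transposition.\<close>

lemma det2_mult3:
  "det2 (\<lambda>j b. \<Sum>c<2. \<Sum>c'<2. f b c * g c c' * h j c') = det2 f * det2 g * det2 h"
  by (simp add: det2_def numeral_2_eq_2 algebra_simps)

fun tensor :: "(nat \<Rightarrow> complex) list \<Rightarrow> nat \<Rightarrow> complex" where
  "tensor [] i = 1"
| "tensor (\<psi> # \<psi>s) i = \<psi> (i div 4 ^ length \<psi>s) * tensor \<psi>s (i mod 4 ^ length \<psi>s)"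

text \<open>The operators \<open>As\<close> belong to the last parties of the chain, and \<open>\<psi>s\<close> are the pure states
  between them; the first of these parties also holds a qubit of another state. The amplitudes are
  those of the image of \<open>|b\<rangle>\<close> (of this qubit) times \<open>\<psi>s\<close>.\<close>

definition amplitude :: "complex mat list \<Rightarrow> (nat \<Rightarrow> complex) list \<Rightarrow> nat \<Rightarrow> nat \<Rightarrow> complex" where
  "amplitude As \<psi>s i b =
     (\<Sum>y<4 ^ length \<psi>s. kron_list As $$ (i, b * 4 ^ length \<psi>s + y) * tensor \<psi>s y)"

lemma div_mod_eqI:
  fixes i j n x :: nat
  assumes "x = i * n + j" "j < n"
  shows "x div n = i" "x mod n = j"
  using assms by auto

text \<open>The boundaries between parties are shifted by one qubit against those between states:
  qubit \<open>c\<close> of \<open>\<psi>\<close> is held by the owner of \<open>A\<close>, qubit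
  \<open>c'\<close> by the next party. The first hypothesis covers both an intermediate party and
  party 0, where \<open>dim_col A = 2\<close> and \<open>b = 0\<close>.\<close>

lemma amplitude_Cons:
  assumes "2 * b + 1 < dim_col A" "dim_col (kron_list As) = 2 * 4 ^ length \<psi>s"
    "i < dim_row A * dim_row (kron_list As)"
  shows "amplitude (A # As) (\<psi> # \<psi>s) i b = (\<Sum>c<2. \<Sum>c'<2. A $$ (i div dim_row (kron_list As), 2 * b + c) *
    \<psi> (2 * c + c') * amplitude As \<psi>s (i mod dim_row (kron_list As)) c')"
proof -
  define n :: nat where "n = 4 ^ length \<psi>s"
  have n: "n > 0" "4 ^ length (\<psi> # \<psi>s) = 4 * n" by (simp_all add: n_def)
  let ?r = "dim_row (kron_list As)"
  have col: "dim_col (kron_list As) = 2 * n" using assms(2) by (simp add: n_def)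
  define f where "f z y = A $$ (i div ?r, 2 * b + z div 2) *
    kron_list As $$ (i mod ?r, (z mod 2) * n + y) * (\<psi> z * tensor \<psi>s y)" for z y
  have entry: "kron_list (A # As) $$ (i, b * (4 * n) + x) * tensor (\<psi> # \<psi>s) x = f (x div n) (x mod n)"
    if x: "x < 4 * n" for x
  proof -
    define z y where "z = x div n" and "y = x mod n"
    have z: "z < 4" and y: "y < n" and x_eq: "x = z * n + y"
      using div_mod_less_mult[OF x] by (auto simp: z_def y_def)
    have zn: "(z mod 2) * n + y < 2 * n" using y by (intro mult_add_less) auto
    \<comment> \<open>One column index in two radices: \<open>4 * n\<close> follows the states,
      \<open>2 * n\<close> follows the parties.\<close>
    have "b * (4 * n) + x = (2 * b + z div 2) * (2 * n) + ((z mod 2) * n + y)"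
    proof -
      have "z * n = (2 * (z div 2) + z mod 2) * n" by simp
      then show ?thesis unfolding x_eq by (simp only: ring_distribs mult_ac)
    qed
    moreover have "2 * b + z div 2 < dim_col A" using assms(1) z by linarith
    ultimately have "(b * (4 * n) + x) div (2 * n) = 2 * b + z div 2"
      "(b * (4 * n) + x) mod (2 * n) = (z mod 2) * n + y" "b * (4 * n) + x < dim_col A * (2 * n)"
      using zn mult_add_less[of "2 * b + z div 2" "dim_col A" "(z mod 2) * n + y" "2 * n"]
      by (simp_all del: mult_Suc_right)
    then show ?thesis
      using assms(3) by (simp add: index_kron col f_def z_def y_def n_def[symmetric])
  qed
  have "amplitude (A # As) (\<psi> # \<psi>s) i b = (\<Sum>x<4 * n. f (x div n) (x mod n))"
    unfolding amplitude_def n(2) by (intro sum.cong refl entry) simp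
  also have "\<dots> = (\<Sum>z<4. \<Sum>y<n. f z y)"
    by (rule sum_div_mod)
  also have "\<dots> = (\<Sum>z<2 * 2. A $$ (i div ?r, 2 * b + z div 2) * \<psi> (2 * (z div 2) + z mod 2) *
      amplitude As \<psi>s (i mod ?r) (z mod 2))"
    by (simp add: f_def amplitude_def n_def sum_distrib_left mult_ac)
  also have "\<dots> = (\<Sum>c<2. \<Sum>c'<2. A $$ (i div ?r, 2 * b + c) * \<psi> (2 * c + c') *
      amplitude As \<psi>s (i mod ?r) c')"
    by (rule sum_div_mod)
  finally show ?thesis .
qed

definition vec_det2 :: "(nat \<Rightarrow> complex) \<Rightarrow> complex" where
  "vec_det2 \<psi> = det2 (\<lambda>c c'. \<psi> (2 * c + c'))"

text \<open>Induction from party N towards the front. Here \<open>j\<close> is the qubit kept by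
  party N, \<open>b\<close> the open input qubit of the first party in \<open>As\<close>, and
  \<open>k\<close> runs over everything traced out. The dimensions belong to the claim because the
  step splits indices by them.\<close>

lemma sum_cmod_det2_amplitude_le:
  assumes "length As = Suc (length \<psi>s)" "\<forall>A\<in>set (butlast As). dim_col A = 4"
    "dim_col (last As) = 2" "even (dim_row (last As))"
  shows "even (dim_row (kron_list As)) \<and> dim_col (kron_list As) = 2 * 4 ^ length \<psi>s \<and>
    (\<Sum>k<dim_row (kron_list As) div 2. cmod (det2 (\<lambda>j b. amplitude As \<psi>s (2 * k + j) b)))
      \<le> (\<Prod>A\<leftarrow>As. frob A / 2) * (\<Prod>\<psi>\<leftarrow>\<psi>s. cmod (vec_det2 \<psi>))"
  using assms
proof (induction \<psi>s arbitrary: As)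
  case Nil
  then obtain A where As: "As = [A]" by (cases As) auto
  from Nil As obtain a where "dim_row A = 2 * a" by auto
  with Nil As sum_cmod_det2_fibre_le(2)[of A a] show ?case
    by (simp add: amplitude_def del: One_nat_def)
next
  case (Cons \<psi> \<psi>s)
  from Cons.prems(1) obtain A As' where As: "As = A # As'" "length As' = Suc (length \<psi>s)"
    by (cases As) auto
  then have "As' \<noteq> []" by auto
  with Cons.prems As have A: "dim_col A = 4" and prems: "\<forall>A\<in>set (butlast As'). dim_col A = 4"
    "dim_col (last As') = 2" "even (dim_row (last As'))"
    by auto
  let ?G = "\<lambda>k. det2 (\<lambda>j b. amplitude As' \<psi>s (2 * k + j) b)"
  from Cons.IH[OF As(2) prems] obtain h where h: "dim_row (kron_list As') = 2 * h"
    and col: "dim_col (kron_list As') = 2 * 4 ^ length \<psi>s"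
    and IH: "(\<Sum>k<h. cmod (?G k)) \<le> (\<Prod>A\<leftarrow>As'. frob A / 2) * (\<Prod>\<psi>\<leftarrow>\<psi>s. cmod (vec_det2 \<psi>))"
    by (auto elim!: evenE)
  let ?D = "\<lambda>i. det2 (\<lambda>b c. A $$ (i, 2 * b + c))"
  \<comment> \<open>The leading digit \<open>k div h\<close> is the output of the first party,
    \<open>k mod h\<close> that of the later parties without the kept qubit. The matrix is a product
    of three, up to transposition.\<close>
  have det: "det2 (\<lambda>j b. amplitude As (\<psi> # \<psi>s) (2 * k + j) b)
      = ?D (k div h) * vec_det2 \<psi> * ?G (k mod h)" if k: "k < dim_row A * h" for k
  proof -
    have amp: "amplitude As (\<psi> # \<psi>s) (2 * k + j) b
      = (\<Sum>c<2. \<Sum>c'<2. A $$ (k div h, 2 * b + c) * \<psi> (2 * c + c') * amplitude As' \<psi>s (2 * (k mod h) + j) c')"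
      if "j < 2" "b < 2" for j b
    proof -
      have "2 * (k mod h) + j < 2 * h"
        using that mult_add_less[OF div_mod_less_mult(2)[OF k] that(1)] by (simp add: mult.commute)
      moreover have "2 * k + j = (k div h) * (2 * h) + (2 * (k mod h) + j)"
        by (metis add.assoc div_mult_mod_eq distrib_left mult.left_commute)
      ultimately have "(2 * k + j) div (2 * h) = k div h" "(2 * k + j) mod (2 * h) = 2 * (k mod h) + j"
        using div_mod_eqI by blast+
      moreover have "2 * k + j < dim_row A * (2 * h)"
        using mult_add_less[OF k that(1)] by (simp add: mult_ac)
      ultimately show ?thesis
        unfolding As using that A by (subst amplitude_Cons) (auto simp: h col)
    qed
    have "det2 (\<lambda>j b. amplitude As (\<psi> # \<psi>s) (2 * k + j) b) = det2 (\<lambda>j b. \<Sum>c<2. \<Sum>c'<2.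
        A $$ (k div h, 2 * b + c) * \<psi> (2 * c + c') * amplitude As' \<psi>s (2 * (k mod h) + j) c')"
      by (rule det2_cong) (rule amp)
    then show ?thesis
      by (simp only: det2_mult3 vec_det2_def)
  qed
  have "(\<Sum>k<dim_row A * h. cmod (det2 (\<lambda>j b. amplitude As (\<psi> # \<psi>s) (2 * k + j) b)))
      = (\<Sum>k<dim_row A * h. cmod (?D (k div h)) * cmod (vec_det2 \<psi>) * cmod (?G (k mod h)))"
    by (rule sum.cong[OF refl], subst det) (simp_all only: lessThan_iff norm_mult)
  also have "\<dots> = (\<Sum>i<dim_row A. \<Sum>k<h. cmod (?D i) * cmod (vec_det2 \<psi>) * cmod (?G k))"
    by (rule sum_div_mod)
  also have "\<dots> = (\<Sum>i<dim_row A. cmod (?D i)) * cmod (vec_det2 \<psi>) * (\<Sum>k<h. cmod (?G k))"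
    by (simp only: sum_distrib_left[symmetric] sum_distrib_right[symmetric])
  also have "\<dots> \<le> (frob A / 2) * cmod (vec_det2 \<psi>) *
      ((\<Prod>A\<leftarrow>As'. frob A / 2) * (\<Prod>\<psi>\<leftarrow>\<psi>s. cmod (vec_det2 \<psi>)))"
    by (intro mult_mono IH sum_cmod_det2_row_le A)
      (auto intro!: sum_nonneg mult_nonneg_nonneg simp: frob_nonneg)
  finally show ?case
    by (simp add: As h col A mult_ac)
qed

text \<open>Party 0 closes the chain. It has no open qubit, whence the argument 0 of
  \<open>amplitude\<close>, and its kept qubit \<open>a\<close> is the leading digit of the output
  index. The traced-out index \<open>k\<close> thus lies between \<open>a\<close> and the last digit
  \<open>b\<close>.\<close>

lemma sum_cmod_det2_chain_le:
  assumes "length As = length \<psi>s" "\<psi>s \<noteq> []" "\<forall>B\<in>set (butlast As). dim_col B = 4"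
    "dim_col (last As) = 2" "even (dim_row (last As))" "dim_col A = 2" "even (dim_row A)"
    "dim_row (kron_list (A # As)) = R"
  shows "4 dvd R" "dim_col (kron_list (A # As)) = 4 ^ length \<psi>s"
    and "(\<Sum>k<R div 4. cmod (det2 (\<lambda>a b. amplitude (A # As) \<psi>s ((a * (R div 4) + k) * 2 + b) 0)))
    \<le> (\<Prod>B\<leftarrow>A # As. frob B / 2) * (\<Prod>\<psi>\<leftarrow>\<psi>s. cmod (vec_det2 \<psi>))"
proof -
  obtain \<psi> \<psi>s' where \<psi>s: "\<psi>s = \<psi> # \<psi>s'" using assms(2) by (cases \<psi>s) auto
  from assms(7) obtain a\<^sub>0 where a\<^sub>0: "dim_row A = 2 * a\<^sub>0" by auto
  let ?G = "\<lambda>k. det2 (\<lambda>j b. amplitude As \<psi>s' (2 * k + j) b)"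
  from sum_cmod_det2_amplitude_le[of As \<psi>s'] assms obtain h where
    h: "dim_row (kron_list As) = 2 * h" and col: "dim_col (kron_list As) = 2 * 4 ^ length \<psi>s'"
    and G: "(\<Sum>k<h. cmod (?G k)) \<le> (\<Prod>A\<leftarrow>As. frob A / 2) * (\<Prod>\<psi>\<leftarrow>\<psi>s'. cmod (vec_det2 \<psi>))"
    by (auto simp: \<psi>s elim!: evenE)
  show "dim_col (kron_list (A # As)) = 4 ^ length \<psi>s"
    using assms(6) col by (simp add: \<psi>s)
  show "4 dvd R"
    using assms(8) by (auto simp: a\<^sub>0 h)
  have R: "R div 4 = a\<^sub>0 * h" "R = (2 * a\<^sub>0) * (2 * h)" using assms(8) by (simp_all add: a\<^sub>0 h)
  let ?D = "\<lambda>i. det2 (\<lambda>b c. A $$ (b * a\<^sub>0 + i, c))"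
  have det: "det2 (\<lambda>a b. amplitude (A # As) \<psi>s ((a * (a\<^sub>0 * h) + k) * 2 + b) 0)
      = ?D (k div h) * vec_det2 \<psi> * ?G (k mod h)" if k: "k < a\<^sub>0 * h" for k
  proof -
    note kh = div_mod_less_mult[OF k]
    have amp: "amplitude (A # As) \<psi>s ((a * (a\<^sub>0 * h) + k) * 2 + b) 0
      = (\<Sum>c<2. \<Sum>c'<2. A $$ (a * a\<^sub>0 + k div h, c) * \<psi> (2 * c + c') * amplitude As \<psi>s' (2 * (k mod h) + b) c')"
      if "a < 2" "b < 2" for a b
    proof -
      let ?i = "(a * (a\<^sub>0 * h) + k) * 2 + b"
      have r: "2 * (k mod h) + b < 2 * h"
        using that mult_add_less[OF kh(2) that(2)] by (simp add: mult.commute)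
      have "?i = (a * a\<^sub>0 + k div h) * (2 * h) + (2 * (k mod h) + b)"
      proof -
        have "k * 2 = (k div h * h + k mod h) * 2" by simp
        then show ?thesis by (simp only: ring_distribs mult_ac add_ac)
      qed
      note eq = this
      have "?i div (2 * h) = a * a\<^sub>0 + k div h" "?i mod (2 * h) = 2 * (k mod h) + b"
        using div_mod_eqI[OF eq r] by auto
      moreover have "?i < dim_row A * (2 * h)"
        unfolding eq a\<^sub>0 by (rule mult_add_less[OF mult_add_less[OF that(1) kh(1)] r])
      ultimately show ?thesis
        unfolding \<psi>s using assms(6) by (subst amplitude_Cons) (auto simp: h col)
    qed
    have "det2 (\<lambda>a b. amplitude (A # As) \<psi>s ((a * (a\<^sub>0 * h) + k) * 2 + b) 0)
      = det2 (\<lambda>a b. \<Sum>c<2. \<Sum>c'<2. A $$ (a * a\<^sub>0 + k div h, c) * \<psi> (2 * c + c') *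
          amplitude As \<psi>s' (2 * (k mod h) + b) c')"
      by (rule det2_cong) (rule amp)
    \<comment> \<open>The transposed matrix, which has the same determinant.\<close>
    also have "\<dots> = det2 (\<lambda>b a. \<Sum>c'<2. \<Sum>c<2. amplitude As \<psi>s' (2 * (k mod h) + b) c' *
          \<psi> (2 * c + c') * A $$ (a * a\<^sub>0 + k div h, c))"
      by (simp add: det2_def numeral_2_eq_2 algebra_simps)
    also have "\<dots> = ?D (k div h) * vec_det2 \<psi> * ?G (k mod h)"
      by (simp add: det2_def vec_det2_def numeral_2_eq_2 algebra_simps)
    finally show ?thesis .
  qed
  have "(\<Sum>k<a\<^sub>0 * h. cmod (det2 (\<lambda>a b. amplitude (A # As) \<psi>s ((a * (a\<^sub>0 * h) + k) * 2 + b) 0)))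
      = (\<Sum>k<a\<^sub>0 * h. cmod (?D (k div h)) * cmod (vec_det2 \<psi>) * cmod (?G (k mod h)))"
    by (rule sum.cong[OF refl], subst det) (simp_all only: lessThan_iff norm_mult)
  also have "\<dots> = (\<Sum>i<a\<^sub>0. \<Sum>k<h. cmod (?D i) * cmod (vec_det2 \<psi>) * cmod (?G k))"
    by (rule sum_div_mod)
  also have "\<dots> = (\<Sum>i<a\<^sub>0. cmod (?D i)) * cmod (vec_det2 \<psi>) * (\<Sum>k<h. cmod (?G k))"
    by (simp only: sum_distrib_left[symmetric] sum_distrib_right[symmetric])
  also have "\<dots> \<le> (frob A / 2) * cmod (vec_det2 \<psi>) *
      ((\<Prod>A\<leftarrow>As. frob A / 2) * (\<Prod>\<psi>\<leftarrow>\<psi>s'. cmod (vec_det2 \<psi>)))"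
    by (intro mult_mono G sum_cmod_det2_fibre_le assms a\<^sub>0)
      (auto intro!: sum_nonneg mult_nonneg_nonneg simp: frob_nonneg)
  finally show "(\<Sum>k<R div 4. cmod (det2 (\<lambda>a b. amplitude (A # As) \<psi>s ((a * (R div 4) + k) * 2 + b) 0)))
    \<le> (\<Prod>B\<leftarrow>A # As. frob B / 2) * (\<Prod>\<psi>\<leftarrow>\<psi>s. cmod (vec_det2 \<psi>))"
    by (simp add: \<psi>s R mult_ac)
qed

section \<open>Concurrence\<close>

lemma sum_lessThan_4: "(\<Sum>i<4::nat. f i) = f 0 + f 1 + f 2 + (f 3 :: 'a::comm_monoid_add)"
  by (simp add: eval_nat_numeral)

text \<open>With the coefficient matrix V, the reduced state is r = V V^dagger. Hence 1 - Tr r^2 =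
  (Tr r)^2 - Tr r^2 = 2 det r = 2 |det V|^2.\<close>

lemma pure_concurrence_eq:
  assumes "pure_state 4 v"
  shows "pure_concurrence v = 2 * cmod (vec_det2 (($) v))"
proof -
  define a b c d where "a = v $ 0" and "b = v $ 1" and "c = v $ 2" and "d = v $ 3"
  have v: "dim_vec v = 4" and norm: "a * cnj a + b * cnj b + c * cnj c + d * cnj d = 1"
    using assms by (auto simp: pure_state_def scalar_prod_def atLeast0LessThan sum_lessThan_4
        a_def b_def c_def d_def)
  define r where "r = partial_trace 2 2 1 (ket_bra v)"
  have r: "r \<in> carrier_mat 2 2" by (simp add: r_def partial_trace_def)
  have entries: "r $$ (0, 0) = a * cnj a + b * cnj b" "r $$ (0, 1) = a * cnj c + b * cnj d"
    "r $$ (1, 0) = c * cnj a + d * cnj b" "r $$ (1, 1) = c * cnj c + d * cnj d"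
    by (simp_all add: r_def partial_trace_def ket_bra_def v a_def b_def c_def d_def numeral_2_eq_2
        numeral_3_eq_3)
  have "mat_trace (r * r) = r $$ (0, 0) * r $$ (0, 0) + 2 * r $$ (0, 1) * r $$ (1, 0) + r $$ (1, 1) * r $$ (1, 1)"
    using r by (simp add: mat_trace_def scalar_prod_def numeral_2_eq_2 algebra_simps)
  \<comment> \<open>Replacing 1 by the square of the norm makes the claim a polynomial
    identity.\<close>
  then have "1 - mat_trace (r * r) = (a * cnj a + b * cnj b + c * cnj c + d * cnj d)\<^sup>2 - mat_trace (r * r)"
    "mat_trace (r * r) = (a * cnj a + b * cnj b)\<^sup>2 + 2 * (a * cnj c + b * cnj d) * (c * cnj a + d * cnj b)
      + (c * cnj c + d * cnj d)\<^sup>2"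
    by (simp_all add: norm entries power2_eq_square del: One_nat_def)
  then have "1 - mat_trace (r * r) = 2 * ((a * d - b * c) * cnj (a * d - b * c))"
    by (simp add: power2_eq_square algebra_simps)
  also have "\<dots> = complex_of_real (2 * (cmod (a * d - b * c))\<^sup>2)"
    by (simp add: complex_norm_square del: of_real_power)
  finally have "Re (1 - mat_trace (r * r)) = 2 * (cmod (a * d - b * c))\<^sup>2"
    by (simp only: Re_complex_of_real)
  then have eq: "2 * (1 - Re (mat_trace (r * r))) = (2 * cmod (a * d - b * c))\<^sup>2"
    by (simp add: power_mult_distrib)
  have "pure_concurrence v = 2 * cmod (a * d - b * c)"
    unfolding pure_concurrence_def r_def[symmetric] Let_def eq real_sqrt_abs by simp
  then show ?thesis
    by (simp add: vec_det2_def det2_def a_def b_def c_def d_def numeral_2_eq_2 numeral_3_eq_3)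
qed

text \<open>The decompositions into pure states with the square roots of the probabilities absorbed into
  the vectors.\<close>

definition rank1_decomposition :: "nat \<Rightarrow> complex mat \<Rightarrow> (nat \<Rightarrow> complex) list \<Rightarrow> bool" where
  "rank1_decomposition n A \<psi>s \<longleftrightarrow> A \<in> carrier_mat n n \<and>
     (\<forall>i<n. \<forall>j<n. A $$ (i, j) = (\<Sum>\<psi>\<leftarrow>\<psi>s. \<psi> i * cnj (\<psi> j)))"

lemma vec_det2_scale: "vec_det2 (\<lambda>i. c * \<psi> i) = c\<^sup>2 * vec_det2 \<psi>"
  by (simp add: vec_det2_def det2_def power2_eq_square algebra_simps)

text \<open>The determinant is quadratic in the vector, so an absorbed factor \<open>sqrt p\<close>
  reappears as the weight \<open>p\<close>.\<close>

lemma pure_decomposition_imp_rank1: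
  assumes "pure_decomposition A D"
  shows "\<exists>\<psi>s. rank1_decomposition 4 A \<psi>s \<and>
    (\<Sum>\<psi>\<leftarrow>\<psi>s. 2 * cmod (vec_det2 \<psi>)) = (\<Sum>(p, v)\<leftarrow>D. p * pure_concurrence v)"
proof (intro exI conjI)
  let ?\<psi> = "\<lambda>(p, v) i. complex_of_real (sqrt p) * v $ i"
  have D: "0 \<le> p \<and> pure_state 4 v" if "(p, v) \<in> set D" for p v
    using assms that by (auto simp: pure_decomposition_def)
  have A: "A = mat_sum 4 (map (\<lambda>(p, v). complex_of_real p \<cdot>\<^sub>m ket_bra v) D)"
    using assms by (simp add: pure_decomposition_def)
  have car: "\<forall>B\<in>set (map (\<lambda>(p, v). complex_of_real p \<cdot>\<^sub>m ket_bra v) D). B \<in> carrier_mat 4 4"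
    using D by (auto simp: ket_bra_def pure_state_def)
  show "rank1_decomposition 4 A (map ?\<psi> D)"
    unfolding rank1_decomposition_def
  proof (intro conjI allI impI)
    show "A \<in> carrier_mat 4 4" unfolding A using car by (rule mat_sum_carrier)
    fix i j :: nat assume ij: "i < 4" "j < 4"
    have "(complex_of_real p \<cdot>\<^sub>m ket_bra v) $$ (i, j) = ?\<psi> (p, v) i * cnj (?\<psi> (p, v) j)"
      if "(p, v) \<in> set D" for p v
    proof -
      have "complex_of_real (sqrt p) * complex_of_real (sqrt p) = complex_of_real p"
        using D[OF that] by (simp flip: of_real_mult)
      then show ?thesis
        using D[OF that] ij by (auto simp: ket_bra_def pure_state_def algebra_simps)
    qed
    then show "A $$ (i, j) = (\<Sum>\<psi>\<leftarrow>map ?\<psi> D. \<psi> i * cnj (\<psi> j))"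
      unfolding A index_mat_sum[OF car ij] map_map comp_def
      by (intro arg_cong[of _ _ sum_list] map_cong[OF refl]) (auto split: prod.splits)
  qed
  have "2 * cmod (vec_det2 (?\<psi> (p, v))) = p * pure_concurrence v" if "(p, v) \<in> set D" for p v
    using D[OF that] by (simp add: pure_concurrence_eq vec_det2_scale norm_mult norm_power)
  then show "(\<Sum>\<psi>\<leftarrow>map ?\<psi> D. 2 * cmod (vec_det2 \<psi>)) = (\<Sum>(p, v)\<leftarrow>D. p * pure_concurrence v)"
    unfolding map_map comp_def
    by (intro arg_cong[of _ _ sum_list] map_cong[OF refl]) (auto split: prod.splits)
qed

lemma mat_trace_rank1:
  assumes "rank1_decomposition n A \<psi>s"
  shows "mat_trace A = complex_of_real (\<Sum>\<psi>\<leftarrow>\<psi>s. \<Sum>i<n. (cmod (\<psi> i))\<^sup>2)"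
proof -
  have "mat_trace A = (\<Sum>i<n. \<Sum>\<psi>\<leftarrow>\<psi>s. \<psi> i * cnj (\<psi> i))"
    using assms by (auto simp: mat_trace_def rank1_decomposition_def intro!: sum.cong)
  also have "\<dots> = (\<Sum>\<psi>\<leftarrow>\<psi>s. \<Sum>i<n. \<psi> i * cnj (\<psi> i))"
    by (induction \<psi>s) (simp_all add: sum.distrib)
  also have "\<dots> = complex_of_real (\<Sum>\<psi>\<leftarrow>\<psi>s. \<Sum>i<n. (cmod (\<psi> i))\<^sup>2)"
    by (induction \<psi>s) (simp_all add: complex_norm_square del: of_real_power)
  finally show ?thesis .
qed

text \<open>Each vector is normalized and gets its squared norm over \<open>t\<close> as
  probability. These add up to one because the trace is the sum of the squared norms.\<close>

lemma rank1_imp_pure_decomposition: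
  assumes "rank1_decomposition 4 A \<psi>s" "mat_trace A = complex_of_real t" "t > 0"
  shows "\<exists>D. pure_decomposition ((1 / complex_of_real t) \<cdot>\<^sub>m A) D \<and>
    (\<Sum>(p, v)\<leftarrow>D. p * pure_concurrence v) = (\<Sum>\<psi>\<leftarrow>\<psi>s. 2 * cmod (vec_det2 \<psi>)) / t"
proof -
  define s where "s \<psi> = (\<Sum>i<4. (cmod (\<psi> i))\<^sup>2)" for \<psi> :: "nat \<Rightarrow> complex"
  \<comment> \<open>A vanishing vector cannot be normalized; an arbitrary unit vector takes its
    place, with probability 0.\<close>
  define v where "v \<psi> = (if s \<psi> = 0 then unit_vec 4 0 else vec 4 (\<lambda>i. complex_of_real (1 / sqrt (s \<psi>)) * \<psi> i))"
    for \<psi> :: "nat \<Rightarrow> complex"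
  have s_nonneg: "0 \<le> s \<psi>" for \<psi> by (simp add: s_def sum_nonneg)
  have zero: "\<psi> i = 0" if "s \<psi> = 0" "i < 4" for \<psi> i
    using that by (simp add: s_def sum_nonneg_eq_0_iff)
  have pure: "pure_state 4 (v \<psi>)" for \<psi>
  proof (cases "s \<psi> = 0")
    case True
    then show ?thesis
      by (simp add: v_def pure_state_def scalar_prod_def atLeast0LessThan sum_lessThan_4)
  next
    case False
    have "z * \<psi> i * cnj (z * \<psi> i) = complex_of_real ((cmod z)\<^sup>2 * (cmod (\<psi> i))\<^sup>2)" for z i
      unfolding of_real_mult complex_norm_square by simp
    from this[of "complex_of_real (1 / sqrt (s \<psi>))"]
    have "v \<psi> \<bullet>c v \<psi> = (\<Sum>i<4. complex_of_real ((1 / sqrt (s \<psi>))\<^sup>2 * (cmod (\<psi> i))\<^sup>2))"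
      using False by (simp add: v_def scalar_prod_def atLeast0LessThan power_divide norm_divide)
    also have "\<dots> = complex_of_real ((1 / sqrt (s \<psi>))\<^sup>2 * s \<psi>)"
      by (simp add: s_def sum_distrib_left)
    also have "\<dots> = 1"
      using False s_nonneg[of \<psi>] by (simp add: power_divide)
    finally show ?thesis using False by (simp add: pure_state_def v_def)
  qed
  have scale: "\<psi> i = complex_of_real (sqrt (s \<psi>)) * v \<psi> $ i" if "i < 4" for \<psi> i
    using that zero[of \<psi> i] by (cases "s \<psi> = 0") (auto simp: v_def)
  define D where "D = map (\<lambda>\<psi>. (s \<psi> / t, v \<psi>)) \<psi>s"
  have car: "A \<in> carrier_mat 4 4"
    and entry: "A $$ (i, j) = (\<Sum>\<psi>\<leftarrow>\<psi>s. \<psi> i * cnj (\<psi> j))" if "i < 4" "j < 4" for i j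
    using assms(1) that by (auto simp: rank1_decomposition_def)
  have carD: "\<forall>B\<in>set (map (\<lambda>(p, v). complex_of_real p \<cdot>\<^sub>m ket_bra v) D). B \<in> carrier_mat 4 4"
    using pure by (auto simp: D_def ket_bra_def pure_state_def)
  have "(\<Sum>\<psi>\<leftarrow>\<psi>s. s \<psi>) = t"
    using mat_trace_rank1[OF assms(1)] assms(2) by (simp add: s_def[symmetric])
  moreover have "(\<Sum>\<psi>\<leftarrow>\<psi>s. s \<psi> / t) = (\<Sum>\<psi>\<leftarrow>\<psi>s. s \<psi>) / t"
    by (induction \<psi>s) (simp_all add: add_divide_distrib)
  ultimately have sum: "(\<Sum>(p, v)\<leftarrow>D. p) = 1"
    using assms(3) by (simp add: D_def comp_def)
  have "(1 / complex_of_real t) \<cdot>\<^sub>m A = mat_sum 4 (map (\<lambda>(p, v). complex_of_real p \<cdot>\<^sub>m ket_bra v) D)"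
    (is "_ = ?S")
  proof (rule eq_matI)
    have S: "?S \<in> carrier_mat 4 4" using carD by (rule mat_sum_carrier)
    have A: "A \<in> carrier_mat 4 4" using car[of 0 0] by simp
    show "dim_row ((1 / complex_of_real t) \<cdot>\<^sub>m A) = dim_row ?S"
      "dim_col ((1 / complex_of_real t) \<cdot>\<^sub>m A) = dim_col ?S"
      using S A by auto
    fix i j assume "i < dim_row ?S" "j < dim_col ?S"
    with S have ij: "i < 4" "j < 4" by auto
    have "(complex_of_real (s \<psi> / t) \<cdot>\<^sub>m ket_bra (v \<psi>)) $$ (i, j) = 1 / complex_of_real t * (\<psi> i * cnj (\<psi> j))"
      for \<psi>
    proof -
      have "complex_of_real (sqrt (s \<psi>)) * complex_of_real (sqrt (s \<psi>)) = complex_of_real (s \<psi>)"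
        using s_nonneg[of \<psi>] by (simp flip: of_real_mult)
      then have "\<psi> i * cnj (\<psi> j) = complex_of_real (s \<psi>) * (v \<psi> $ i * cnj (v \<psi> $ j))"
        using scale[OF ij(1), of \<psi>] scale[OF ij(2), of \<psi>]
        by (metis (no_types, opaque_lifting) complex_cnj_complex_of_real complex_cnj_mult
            mult.assoc mult.left_commute)
      moreover have "dim_vec (v \<psi>) = 4"
        using pure[of \<psi>] by (simp add: pure_state_def)
      ultimately show ?thesis
        using ij by (simp add: ket_bra_def)
    qed
    then show "((1 / complex_of_real t) \<cdot>\<^sub>m A) $$ (i, j) = ?S $$ (i, j)"
      unfolding index_mat_sum[OF carD ij] using ij A
      by (simp add: D_def comp_def entry sum_list_const_mult[symmetric])
  qed
  then have "pure_decomposition ((1 / complex_of_real t) \<cdot>\<^sub>m A) D"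
    using sum pure s_nonneg assms(3) by (auto simp: pure_decomposition_def D_def)
  moreover have "(\<Sum>(p, v)\<leftarrow>D. p * pure_concurrence v) = (\<Sum>\<psi>\<leftarrow>\<psi>s. 2 * cmod (vec_det2 \<psi>)) / t"
  proof -
    have det: "vec_det2 \<psi> = complex_of_real (s \<psi>) * vec_det2 (($) (v \<psi>))" for \<psi>
    proof -
      have "vec_det2 \<psi> = vec_det2 (\<lambda>i. complex_of_real (sqrt (s \<psi>)) * v \<psi> $ i)"
        using scale[of _ \<psi>] by (simp add: vec_det2_def det2_def)
      also have "\<dots> = complex_of_real (s \<psi>) * vec_det2 (($) (v \<psi>))"
        unfolding vec_det2_scale using s_nonneg[of \<psi>] by (simp flip: of_real_power)
      finally show ?thesis .
    qed
    have "s \<psi> / t * pure_concurrence (v \<psi>) = 1 / t * (2 * cmod (vec_det2 \<psi>))" for \<psi>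
      unfolding pure_concurrence_eq[OF pure] using s_nonneg[of \<psi>]
      by (subst det) (simp add: norm_mult)
    then show ?thesis
      unfolding D_def map_map comp_def prod.case by (simp only: sum_list_const_mult) simp
  qed
  ultimately show ?thesis by blast
qed

lemma concurrence_le:
  assumes "pure_decomposition A D"
  shows "concurrence A \<le> (\<Sum>(p, v)\<leftarrow>D. p * pure_concurrence v)"
  unfolding concurrence_def
proof (rule cInf_lower)
  have "0 \<le> (\<Sum>(p, v)\<leftarrow>D. p * pure_concurrence v)" if "pure_decomposition A D" for D
    using that by (intro sum_list_nonneg)
      (force simp: pure_decomposition_def pure_concurrence_eq)
  then show "bdd_below {\<Sum>(p, v)\<leftarrow>D. p * pure_concurrence v |D. pure_decomposition A D}"
    by (intro bdd_belowI[of _ 0]) auto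
qed (use assms in blast)

lemma mult_concurrence_normalized_le:
  assumes "rank1_decomposition 4 A \<psi>s" "mat_trace A = complex_of_real t" "t \<ge> 0"
  shows "t * concurrence ((1 / complex_of_real t) \<cdot>\<^sub>m A) \<le> (\<Sum>\<psi>\<leftarrow>\<psi>s. 2 * cmod (vec_det2 \<psi>))"
proof (cases "t = 0")
  \<comment> \<open>An outcome of probability 0: the left side vanishes whatever
    \<open>concurrence\<close> yields for the zero matrix.\<close>
  case True
  then show ?thesis by (auto intro!: sum_list_nonneg)
next
  case False
  with assms(3) have "t > 0" by simp
  from rank1_imp_pure_decomposition[OF assms(1,2) this] concurrence_le
  have "concurrence ((1 / complex_of_real t) \<cdot>\<^sub>m A) \<le> (\<Sum>\<psi>\<leftarrow>\<psi>s. 2 * cmod (vec_det2 \<psi>)) / t"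
    by metis
  with \<open>t > 0\<close> show ?thesis by (simp add: field_simps)
qed

section \<open>Pure decompositions of density operators\<close>

text \<open>A Cholesky decomposition: the last row and column are removed by subtracting a rank one
  matrix, and the Schur complement is again positive.\<close>

lemma positive_form_rank1:
  fixes a :: "nat \<Rightarrow> nat \<Rightarrow> complex"
  assumes "\<And>x. 0 \<le> (\<Sum>i<n. \<Sum>j<n. cnj (x i) * a i j * x j)"
  shows "\<exists>\<psi>s. \<forall>i<n. \<forall>j<n. a i j = (\<Sum>\<psi>\<leftarrow>\<psi>s. \<psi> i * cnj (\<psi> j))"
  using assms
proof (induction n arbitrary: a)
  case (Suc n)
  let ?q = "\<lambda>x. \<Sum>i<n. \<Sum>j<n. cnj (x i) * a i j * x j"
  have form: "0 \<le> ?q x + (\<Sum>i<n. cnj (x i) * a i n) * y + cnj y * (\<Sum>j<n. a n j * x j) + cnj y * a n n * y"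
    for x y
    using Suc.prems[of "x(n := y)"]
    by (simp add: sum.distrib sum_distrib_left sum_distrib_right mult_ac add_ac)
  have ann: "0 \<le> a n n"
    using form[of "\<lambda>_. 0" 1] by simp
  \<comment> \<open>The form restricted to the coordinates i and n, with values 1 and y.\<close>
  have pair: "0 \<le> a i i + a i n * y + cnj y * a n i + cnj y * a n n * y" if "i < n" for i y
  proof -
    have *: "(\<Sum>k<n. f k * (if k = i then 1 else 0)) = f i"
      "(\<Sum>k<n. cnj (if k = i then 1 else 0) * f k) = f i" for f :: "nat \<Rightarrow> complex"
      using that by (simp_all add: if_distrib[of cnj] if_distrib[of "\<lambda>z. _ * z"]
          if_distrib[of "\<lambda>z. z * _"] cong: if_cong)
    have "?q (\<lambda>k. if k = i then 1 else 0) = a i i"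
      by (simp only: *)
    then show ?thesis
      using form[of "\<lambda>k. if k = i then 1 else 0" y] by (simp only: *)
  qed
  \<comment> \<open>Nonnegative values are real; y = 1 determines the imaginary part of
    \<open>a n i\<close>, and y equal to the imaginary unit its real part.\<close>
  have herm: "a n i = cnj (a i n)" if "i < n" for i
  proof (rule complex_eqI)
    have "Im (a i i) = 0" "Im (a n n) = 0"
      using pair[OF that, of 0] ann by (simp_all add: less_eq_complex_def)
    then show "Re (a n i) = Re (cnj (a i n))" "Im (a n i) = Im (cnj (a i n))"
      using pair[OF that, of 1] pair[OF that, of \<i>] by (simp_all add: less_eq_complex_def)
  qed
  have zero: "a i n = 0" if "i < n" "a n n = 0" for i
  proof -
    define u where "u = a i n * cnj (a i n)"
    have u: "u = complex_of_real ((cmod (a i n))\<^sup>2)"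
      by (simp add: u_def complex_norm_square del: of_real_power)
    have "0 \<le> Re (a i i) - 2 * t * (cmod (a i n))\<^sup>2" for t
    proof -
      have "a i i + a i n * y + cnj y * a n i + cnj y * a n n * y = a i i - 2 * complex_of_real t * u"
        if "y = - complex_of_real t * cnj (a i n)" for y
        using \<open>a n n = 0\<close> herm[OF \<open>i < n\<close>] by (simp add: that u_def)
      with pair[OF that(1)] have "0 \<le> a i i - 2 * complex_of_real t * u" by metis
      then show ?thesis by (simp add: u less_eq_complex_def del: of_real_power)
    qed
    \<comment> \<open>Unless \<open>a i n = 0\<close>, this t gives the form the value -1.\<close>
    from this[of "(Re (a i i) + 1) / (2 * (cmod (a i n))\<^sup>2)"] show ?thesis
      by (cases "a i n = 0") simp_all
  qed
  \<comment> \<open>The last column over the root of the pivot. For \<open>a n n = 0\<close>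
    division by zero yields the zero vector, consistent with \<open>zero\<close>.\<close>
  define \<psi>\<^sub>0 where "\<psi>\<^sub>0 i = a i n / complex_of_real (sqrt (Re (a n n)))" for i
  have ann_eq: "complex_of_real (sqrt (Re (a n n))) * complex_of_real (sqrt (Re (a n n))) = a n n"
    using ann by (simp add: less_eq_complex_def complex_eq_iff flip: of_real_mult)
  have \<psi>\<^sub>0: "\<psi>\<^sub>0 i * cnj (\<psi>\<^sub>0 j) = a i n * cnj (a j n) / a n n" for i j
    by (simp add: \<psi>\<^sub>0_def ann_eq)
  have schur: "0 \<le> (\<Sum>i<n. \<Sum>j<n. cnj (x i) * (a i j - a i n * a n j / a n n) * x j)" for x
  proof -
    define R S where "R = (\<Sum>i<n. cnj (x i) * a i n)" and "S = (\<Sum>j<n. a n j * x j)"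
    have "(\<Sum>i<n. \<Sum>j<n. cnj (x i) * (a i j - a i n * a n j / a n n) * x j) = ?q x - R * S / a n n"
    proof -
      have "R * S = (\<Sum>i<n. \<Sum>j<n. cnj (x i) * a i n * (a n j * x j))"
        by (simp only: R_def S_def sum_product)
      moreover have "cnj (x i) * (a i j - a i n * a n j / a n n) * x j
          = cnj (x i) * a i j * x j - cnj (x i) * a i n * (a n j * x j) / a n n" for i j
        by (simp add: algebra_simps)
      ultimately show ?thesis
        by (simp only: sum_divide_distrib sum_subtractf)
    qed
    \<comment> \<open>Completing the square: y = \<open>- S / a n n\<close> makes the last two terms
      of the form cancel. If \<open>a n n = 0\<close>, then y and the subtracted term are both
      0.\<close>
    also have "\<dots> = ?q x + R * (- S / a n n) + cnj (- S / a n n) * S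
        + cnj (- S / a n n) * a n n * (- S / a n n)"
      by (cases "a n n = 0") simp_all
    finally show ?thesis
      using form[of x "- S / a n n"] by (simp only: R_def[symmetric] S_def[symmetric])
  qed
  from Suc.IH[OF schur] obtain \<psi>s where
    \<psi>s: "\<And>i j. i < n \<Longrightarrow> j < n \<Longrightarrow> a i j - a i n * a n j / a n n = (\<Sum>\<psi>\<leftarrow>\<psi>s. \<psi> i * cnj (\<psi> j))"
    by blast
  \<comment> \<open>The induction hypothesis says nothing about coordinate n; it is set to 0, as
    \<open>\<psi>\<^sub>0\<close> alone produces the last row and column.\<close>
  let ?\<psi>s = "\<psi>\<^sub>0 # map (\<lambda>\<psi>. \<psi>(n := 0)) \<psi>s"
  have "a i j = (\<Sum>\<psi>\<leftarrow>?\<psi>s. \<psi> i * cnj (\<psi> j))" if ij: "i < Suc n" "j < Suc n" for i j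
  proof -
    have cnj_ann: "cnj (a n n) = a n n"
      using ann by (simp add: less_eq_complex_def complex_eq_iff)
    consider "i < n" "j < n" | "i < n" "j = n" | "i = n" "j < n" | "i = n" "j = n"
      using ij unfolding less_Suc_eq by blast
    then show ?thesis
    proof cases
      case 1
      then have "i \<noteq> n" "j \<noteq> n" by auto
      then show ?thesis
        using \<psi>s[OF 1, symmetric] herm[OF 1(2)] by (simp add: \<psi>\<^sub>0 comp_def)
    next
      case 2
      then show ?thesis using zero[OF 2(1)] by (simp add: \<psi>\<^sub>0 cnj_ann comp_def)
    next
      case 3
      then show ?thesis using zero[OF 3(2)] herm[OF 3(2)] by (simp add: \<psi>\<^sub>0 comp_def)
    next
      case 4
      then show ?thesis by (simp add: \<psi>\<^sub>0 cnj_ann comp_def)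
    qed
  qed
  then show ?case by (intro exI[of _ ?\<psi>s] allI impI)
qed simp

text \<open>This makes the set whose \<open>Inf\<close> defines \<open>concurrence\<close>
  nonempty.\<close>

lemma density_operator_pure_decomposition:
  assumes "density_operator 4 A"
  shows "\<exists>D. pure_decomposition A D"
proof -
  have A: "A \<in> carrier_mat 4 4" and tr: "mat_trace A = 1"
    and pos: "\<And>v. v \<in> carrier_vec 4 \<Longrightarrow> 0 \<le> (A *\<^sub>v v) \<bullet>c v"
    using assms by (auto simp: density_operator_def)
  have "0 \<le> (\<Sum>i<4. \<Sum>j<4. cnj (x i) * A $$ (i, j) * x j)" for x
  proof -
    have "(A *\<^sub>v vec 4 x) \<bullet>c vec 4 x = (\<Sum>i<4. \<Sum>j<4. cnj (x i) * A $$ (i, j) * x j)"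
      using A by (simp add: scalar_prod_def atLeast0LessThan sum_distrib_left sum_distrib_right mult_ac)
    with pos[of "vec 4 x"] show ?thesis by simp
  qed
  from positive_form_rank1[OF this] A obtain \<psi>s where "rank1_decomposition 4 A \<psi>s"
    by (auto simp: rank1_decomposition_def)
  moreover have "1 \<cdot>\<^sub>m A = A" by (rule eq_matI) auto
  ultimately show ?thesis using rank1_imp_pure_decomposition[of A \<psi>s 1] tr by auto
qed

text \<open>An infimum is approached within every \<epsilon>; the main proof lets \<epsilon> tend to
  0 at the end.\<close>

lemma concurrence_approx:
  assumes "density_operator 4 A" "\<epsilon> > 0"
  shows "\<exists>\<psi>s. rank1_decomposition 4 A \<psi>s \<and> (\<Sum>\<psi>\<leftarrow>\<psi>s. 2 * cmod (vec_det2 \<psi>)) \<le> concurrence A + \<epsilon>"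
proof -
  let ?S = "{\<Sum>(p, v)\<leftarrow>D. p * pure_concurrence v |D. pure_decomposition A D}"
  have "?S \<noteq> {}" using density_operator_pure_decomposition[OF assms(1)] by auto
  from cInf_lessD[OF this, of "concurrence A + \<epsilon>"] assms(2) obtain D
    where "pure_decomposition A D" "(\<Sum>(p, v)\<leftarrow>D. p * pure_concurrence v) < concurrence A + \<epsilon>"
    by (auto simp: concurrence_def)
  with pure_decomposition_imp_rank1 show ?thesis by (metis less_imp_le)
qed

section \<open>Outcomes of a protocol\<close>

lemma rank1_kron:
  assumes "rank1_decomposition m A us" "rank1_decomposition n B vs"
  shows "rank1_decomposition (m * n) (A \<otimes>\<^sub>m B)
    (concat (map (\<lambda>u. map (\<lambda>v i. u (i div n) * v (i mod n)) vs) us))"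
  unfolding rank1_decomposition_def
proof (intro conjI allI impI)
  have dims: "A \<in> carrier_mat m m" "B \<in> carrier_mat n n"
    using assms by (auto simp: rank1_decomposition_def)
  then show "A \<otimes>\<^sub>m B \<in> carrier_mat (m * n) (m * n)"
    by auto
  fix i j assume ij: "i < m * n" "j < m * n"
  note bounds = div_mod_less_mult[OF ij(1)] div_mod_less_mult[OF ij(2)]
  have "(A \<otimes>\<^sub>m B) $$ (i, j) = A $$ (i div n, j div n) * B $$ (i mod n, j mod n)"
    using dims ij by (simp add: index_kron)
  also have "\<dots> = (\<Sum>u\<leftarrow>us. u (i div n) * cnj (u (j div n))) * (\<Sum>v\<leftarrow>vs. v (i mod n) * cnj (v (j mod n)))"
    using assms bounds by (simp add: rank1_decomposition_def)
  also have "\<dots> = (\<Sum>u\<leftarrow>us. \<Sum>v\<leftarrow>vs. u (i div n) * cnj (u (j div n)) * (v (i mod n) * cnj (v (j mod n))))"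
    by (simp only: sum_list_const_mult sum_list_mult_const)
  also have "\<dots> = (\<Sum>\<psi>\<leftarrow>concat (map (\<lambda>u. map (\<lambda>v i. u (i div n) * v (i mod n)) vs) us). \<psi> i * cnj (\<psi> j))"
    by (simp add: sum_list_map_concat comp_def mult_ac)
  finally show "(A \<otimes>\<^sub>m B) $$ (i, j)
    = (\<Sum>\<psi>\<leftarrow>concat (map (\<lambda>u. map (\<lambda>v i. u (i div n) * v (i mod n)) vs) us). \<psi> i * cnj (\<psi> j))" .
qed

text \<open>A product of mixtures multiplies out into one product vector per choice of a pure state
  at each link.\<close>

lemma rank1_kron_list:
  assumes "\<forall>k\<in>set ks. rank1_decomposition 4 (\<rho> k) (\<Psi> k)"
  shows "rank1_decomposition (4 ^ length ks) (kron_list (map \<rho> ks)) (map tensor (product_lists (map \<Psi> ks)))"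
  using assms
proof (induction ks)
  case Nil
  then show ?case by (simp add: rank1_decomposition_def)
next
  case (Cons k ks)
  have eq: "map tensor (product_lists (map \<Psi> (k # ks))) = concat (map (\<lambda>u. map (\<lambda>v i.
      u (i div 4 ^ length ks) * v (i mod 4 ^ length ks)) (map tensor (product_lists (map \<Psi> ks)))) (\<Psi> k))"
  proof -
    have "map (\<lambda>\<psi>s. tensor (u # \<psi>s)) (product_lists (map \<Psi> ks)) = map (\<lambda>\<psi>s i.
      u (i div 4 ^ length ks) * tensor \<psi>s (i mod 4 ^ length ks)) (product_lists (map \<Psi> ks))" for u
      by (rule map_cong[OF refl]) (auto simp: fun_eq_iff dest: in_set_product_lists_length)
    then show ?thesis by (simp only: list.map product_lists.simps map_concat map_map comp_def)
  qed
  have "rank1_decomposition 4 (\<rho> k) (\<Psi> k)"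
    "rank1_decomposition (4 ^ length ks) (kron_list (map \<rho> ks)) (map tensor (product_lists (map \<Psi> ks)))"
    using Cons by auto
  from rank1_kron[OF this] show ?case
    unfolding eq by (simp only: list.map kron_list_simps length_Cons power_Suc)
qed

lemma rank1_conjugate:
  assumes "rank1_decomposition n X \<Phi>" "K \<in> carrier_mat r n"
  shows "rank1_decomposition r (K * X * mat_adjoint K) (map (\<lambda>\<phi> i. \<Sum>x<n. K $$ (i, x) * \<phi> x) \<Phi>)"
  unfolding rank1_decomposition_def
proof (intro conjI allI impI)
  have X: "X \<in> carrier_mat n n" and entry: "\<And>x y. x < n \<Longrightarrow> y < n \<Longrightarrow> X $$ (x, y) = (\<Sum>\<phi>\<leftarrow>\<Phi>. \<phi> x * cnj (\<phi> y))"
    using assms(1) by (auto simp: rank1_decomposition_def)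
  show "K * X * mat_adjoint K \<in> carrier_mat r r"
    using assms(2) X by auto
  have swap: "(\<Sum>y\<in>I. \<Sum>\<phi>\<leftarrow>\<Phi>. f \<phi> y) = (\<Sum>\<phi>\<leftarrow>\<Phi>. \<Sum>y\<in>I. f \<phi> y)" for f :: "_ \<Rightarrow> nat \<Rightarrow> complex" and I
    by (induction \<Phi>) (simp_all add: sum.distrib)
  fix i j assume ij: "i < r" "j < r"
  have "(K * X * mat_adjoint K) $$ (i, j) = (\<Sum>y<n. (\<Sum>x<n. K $$ (i, x) * X $$ (x, y)) * cnj (K $$ (j, y)))"
    using assms(2) X ij by (simp add: scalar_prod_def atLeast0LessThan)
  also have "\<dots> = (\<Sum>y<n. \<Sum>x<n. \<Sum>\<phi>\<leftarrow>\<Phi>. K $$ (i, x) * (\<phi> x * cnj (\<phi> y)) * cnj (K $$ (j, y)))"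
    by (simp add: entry sum_distrib_right sum_list_const_mult sum_list_mult_const)
  also have "\<dots> = (\<Sum>\<phi>\<leftarrow>\<Phi>. \<Sum>y<n. \<Sum>x<n. K $$ (i, x) * (\<phi> x * cnj (\<phi> y)) * cnj (K $$ (j, y)))"
    by (simp only: swap)
  also have "\<dots> = (\<Sum>\<phi>\<leftarrow>\<Phi>. (\<Sum>x<n. K $$ (i, x) * \<phi> x) * cnj (\<Sum>y<n. K $$ (j, y) * \<phi> y))"
  proof -
    have "(\<Sum>x<n. K $$ (i, x) * \<phi> x) * cnj (\<Sum>y<n. K $$ (j, y) * \<phi> y)
        = (\<Sum>y<n. \<Sum>x<n. K $$ (i, x) * (\<phi> x * cnj (\<phi> y)) * cnj (K $$ (j, y)))" for \<phi>
      by (subst sum.swap) (simp add: sum_product mult_ac)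
    then show ?thesis by simp
  qed
  finally show "(K * X * mat_adjoint K) $$ (i, j)
    = (\<Sum>\<psi>\<leftarrow>map (\<lambda>\<phi> i. \<Sum>x<n. K $$ (i, x) * \<phi> x) \<Phi>. \<psi> i * cnj (\<psi> j))"
    by (simp add: comp_def)
qed

text \<open>Projecting onto the basis vectors of the middle factor cuts each vector into m slices,
  which together decompose the partial trace.\<close>

lemma rank1_partial_trace:
  assumes "rank1_decomposition (4 * m) B \<Phi>"
  shows "rank1_decomposition 4 (partial_trace 2 m 2 B)
    (concat (map (\<lambda>\<phi>. map (\<lambda>k l. \<phi> ((l div 2 * m + k) * 2 + l mod 2)) [0..<m]) \<Phi>))"
  unfolding rank1_decomposition_def
proof (intro conjI allI impI)
  show "partial_trace 2 m 2 B \<in> carrier_mat 4 4"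
    by (simp add: partial_trace_def)
  fix i j :: nat assume ij: "i < 4" "j < 4"
  have bound: "(l div 2 * m + k) * 2 + l mod 2 < 4 * m" if "l < 4" "k < m" for k l
  proof -
    have "l div 2 * m + k < 2 * m" using that by (intro mult_add_less) auto
    from mult_add_less[OF this, of "l mod 2" 2] show ?thesis by simp
  qed
  have swap: "(\<Sum>k<m. \<Sum>\<phi>\<leftarrow>\<Phi>. f \<phi> k) = (\<Sum>\<phi>\<leftarrow>\<Phi>. \<Sum>k<m. f \<phi> k)" for f :: "_ \<Rightarrow> nat \<Rightarrow> complex"
    by (induction \<Phi>) (simp_all add: sum.distrib)
  have "partial_trace 2 m 2 B $$ (i, j) = (\<Sum>k<m. \<Sum>\<phi>\<leftarrow>\<Phi>.
      \<phi> ((i div 2 * m + k) * 2 + i mod 2) * cnj (\<phi> ((j div 2 * m + k) * 2 + j mod 2)))"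
    using assms ij bound by (auto simp: partial_trace_def rank1_decomposition_def intro!: sum.cong)
  then show "partial_trace 2 m 2 B $$ (i, j) = (\<Sum>\<psi>\<leftarrow>concat (map (\<lambda>\<phi>.
      map (\<lambda>k l. \<phi> ((l div 2 * m + k) * 2 + l mod 2)) [0..<m]) \<Phi>). \<psi> i * cnj (\<psi> j))"
    unfolding swap sum_list_map_concat
    by (simp add: comp_def interv_sum_list_conv_sum_set_nat atLeast0LessThan)
qed

lemma mat_trace_partial_trace:
  assumes "dim_row B = 4 * m"
  shows "mat_trace (partial_trace 2 m 2 B) = mat_trace B"
proof -
  let ?f = "\<lambda>i. B $$ (i, i)"
  have "mat_trace (partial_trace 2 m 2 B) = (\<Sum>l<2 * 2. \<Sum>k<m. ?f ((l div 2 * m + k) * 2 + l mod 2))"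
    by (simp add: mat_trace_def partial_trace_def)
  also have "\<dots> = (\<Sum>a<2. \<Sum>b<2. \<Sum>k<m. ?f ((a * m + k) * 2 + b))"
    by (rule sum_div_mod)
  also have "\<dots> = (\<Sum>a<2. \<Sum>k<m. \<Sum>b<2. ?f ((a * m + k) * 2 + b))"
    by (rule sum.cong[OF refl]) (rule sum.swap)
  also have "\<dots> = (\<Sum>x<2 * m. \<Sum>b<2. ?f ((x div m * m + x mod m) * 2 + b))"
    by (rule sum_div_mod[symmetric])
  also have "\<dots> = (\<Sum>x<2 * m. \<Sum>b<2. ?f (x * 2 + b))"
    by (simp only: div_mult_mod_eq)
  also have "\<dots> = (\<Sum>x<2 * m * 2. ?f (x div 2 * 2 + x mod 2))"
    by (rule sum_div_mod[symmetric])
  also have "\<dots> = mat_trace B"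
    by (simp add: mat_trace_def assms mult.commute)
  finally show ?thesis .
qed

text \<open>The slices form one particular decomposition of the reduced state, hence an upper bound;
  the probability cancels the normalization.\<close>

lemma outcome_concurrence_le:
  assumes "rank1_decomposition (4 * m) B \<Phi>"
  shows "Re (mat_trace B) * concurrence ((1 / mat_trace B) \<cdot>\<^sub>m partial_trace 2 m 2 B)
    \<le> (\<Sum>\<phi>\<leftarrow>\<Phi>. 2 * (\<Sum>k<m. cmod (det2 (\<lambda>a b. \<phi> ((a * m + k) * 2 + b)))))"
proof -
  define t where "t = (\<Sum>\<phi>\<leftarrow>\<Phi>. \<Sum>i<4 * m. (cmod (\<phi> i))\<^sup>2)"
  have tr: "mat_trace B = complex_of_real t"
    unfolding t_def by (rule mat_trace_rank1[OF assms])
  have "dim_row B = 4 * m" using assms by (auto simp: rank1_decomposition_def)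
  from mat_trace_partial_trace[OF this] tr have tr': "mat_trace (partial_trace 2 m 2 B) = complex_of_real t"
    by simp
  have "t \<ge> 0" unfolding t_def by (intro sum_list_nonneg) (auto intro!: sum_nonneg)
  from mult_concurrence_normalized_le[OF rank1_partial_trace[OF assms] tr' this]
  have "t * concurrence ((1 / complex_of_real t) \<cdot>\<^sub>m partial_trace 2 m 2 B)
    \<le> (\<Sum>\<phi>\<leftarrow>\<Phi>. \<Sum>k<m. 2 * cmod (vec_det2 (\<lambda>l. \<phi> ((l div 2 * m + k) * 2 + l mod 2))))"
    unfolding sum_list_map_concat
    by (simp add: comp_def interv_sum_list_conv_sum_set_nat atLeast0LessThan)
  moreover have "vec_det2 (\<lambda>l. \<phi> ((l div 2 * m + k) * 2 + l mod 2)) = det2 (\<lambda>a b. \<phi> ((a * m + k) * 2 + b))" for \<phi> k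
    unfolding vec_det2_def by (rule det2_cong) simp
  ultimately show ?thesis
    by (simp add: tr sum_distrib_left)
qed

lemma sum_list_product_lists:
  fixes f :: "'a \<Rightarrow> 'b::comm_semiring_1"
  shows "(\<Sum>xs\<leftarrow>product_lists xss. \<Prod>x\<leftarrow>xs. f x) = (\<Prod>xs\<leftarrow>xss. \<Sum>x\<leftarrow>xs. f x)"
proof (induction xss)
  case (Cons xs xss)
  then show ?case
    by (simp only: product_lists.simps sum_list_map_concat map_map comp_def list.map prod_list.Cons
        sum_list_const_mult sum_list_mult_const)
qed simp

text \<open>The bound for a single outcome. Its one factor 2 comes from the concurrence 2 |det| of
  the end qubits; the factors 2 of the links enter after summation over the outcomes.\<close>

lemma kraus_outcome_concurrence_le:
  fixes N :: nat and G :: "nat \<Rightarrow> complex mat"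
  defines "K \<equiv> kron_list (map G [0..<Suc N])"
  assumes "N \<ge> 1" "\<And>q. q \<le> N \<Longrightarrow> dim_col (G q) = qubit_dim N q \<and> even (dim_row (G q))"
    "\<And>k. k \<in> {1..N} \<Longrightarrow> rank1_decomposition 4 (\<rho> k) (\<Psi> k)" "B = K * chain_state N \<rho> * mat_adjoint K"
  shows "Re (mat_trace B) * concurrence ((1 / mat_trace B) \<cdot>\<^sub>m partial_trace 2 (dim_row B div 4) 2 B)
    \<le> 2 * (\<Prod>q\<le>N. frob (G q) / 2) * (\<Prod>k=1..N. \<Sum>\<psi>\<leftarrow>\<Psi> k. cmod (vec_det2 \<psi>))"
proof -
  define R where "R = dim_row K"
  let ?As = "map G [1..<Suc N]"
  have list: "map G [0..<Suc N] = G 0 # ?As"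
    by (simp add: upt_conv_Cons del: upt_Suc)
  have As: "butlast ?As = map G [1..<N]" "last ?As = G N"
    using assms(2) by simp_all
  have row: "dim_row (kron_list (G 0 # ?As)) = R"
    unfolding R_def K_def list ..
  have prems: "\<forall>B\<in>set (butlast ?As). dim_col B = 4" "dim_col (last ?As) = 2"
    "even (dim_row (last ?As))" "dim_col (G 0) = 2" "even (dim_row (G 0))"
    unfolding As using assms(2,3) by (auto simp: qubit_dim_def)
  note chain = sum_cmod_det2_chain_le[OF _ _ prems row]
  let ?\<Psi> = "product_lists (map \<Psi> [1..<Suc N])"
  have len: "length \<psi>s = N" if "\<psi>s \<in> set ?\<Psi>" for \<psi>s
    using in_set_product_lists_length[OF that] by simp
  have len': "length ?As = length \<psi>s" "\<psi>s \<noteq> []" if "\<psi>s \<in> set ?\<Psi>" for \<psi>s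
    using len[OF that] assms(2) by auto
  \<comment> \<open>These dimensions depend on the list of pure states only through its length, so
    any list of length N serves.\<close>
  have R4: "4 dvd R" and col: "dim_col K = 4 ^ N"
    using chain(1,2)[of "replicate N undefined"] assms(2) unfolding K_def list by auto
  have X: "rank1_decomposition (4 ^ N) (chain_state N \<rho>) (map tensor ?\<Psi>)"
    using rank1_kron_list[of "[1..<Suc N]" \<rho> \<Psi>] assms(4)
    by (simp add: chain_state_def kron_list_def del: upt_Suc)
  have dimB: "dim_row B = R" by (simp add: assms(5) R_def)
  have "rank1_decomposition (4 * (R div 4)) B
      (map (\<lambda>\<phi> i. \<Sum>x<4 ^ N. K $$ (i, x) * \<phi> x) (map tensor ?\<Psi>))"
  proof -
    have R: "4 * (R div 4) = R" using R4 by simp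
    have "K \<in> carrier_mat R (4 ^ N)" using col unfolding R_def by (intro carrier_matI) auto
    from rank1_conjugate[OF X this] show ?thesis
      unfolding assms(5) R .
  qed
  from outcome_concurrence_le[OF this]
  have "Re (mat_trace B) * concurrence ((1 / mat_trace B) \<cdot>\<^sub>m partial_trace 2 (dim_row B div 4) 2 B)
    \<le> (\<Sum>\<psi>s\<leftarrow>?\<Psi>. 2 * (\<Sum>k<R div 4. cmod (det2 (\<lambda>a b.
        \<Sum>x<4 ^ N. K $$ ((a * (R div 4) + k) * 2 + b, x) * tensor \<psi>s x))))"
    by (simp add: dimB comp_def del: upt_Suc)
  also have "\<dots> \<le> (\<Sum>\<psi>s\<leftarrow>?\<Psi>. 2 * ((\<Prod>B\<leftarrow>G 0 # ?As. frob B / 2) * (\<Prod>\<psi>\<leftarrow>\<psi>s. cmod (vec_det2 \<psi>))))"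
  proof (rule sum_list_mono)
    fix \<psi>s assume \<psi>s: "\<psi>s \<in> set ?\<Psi>"
    have "(\<Sum>x<4 ^ N. K $$ (i, x) * tensor \<psi>s x) = amplitude (G 0 # ?As) \<psi>s i 0" for i
      unfolding amplitude_def K_def list len[OF \<psi>s] by simp
    with chain(3)[OF len'[OF \<psi>s]]
    show "2 * (\<Sum>k<R div 4. cmod (det2 (\<lambda>a b.
        \<Sum>x<4 ^ N. K $$ ((a * (R div 4) + k) * 2 + b, x) * tensor \<psi>s x)))
      \<le> 2 * ((\<Prod>B\<leftarrow>G 0 # ?As. frob B / 2) * (\<Prod>\<psi>\<leftarrow>\<psi>s. cmod (vec_det2 \<psi>)))"
      by (simp del: upt_Suc)
  qed
  also have "\<dots> = 2 * (\<Prod>B\<leftarrow>G 0 # ?As. frob B / 2) * (\<Prod>xs\<leftarrow>map \<Psi> [1..<Suc N]. \<Sum>\<psi>\<leftarrow>xs. cmod (vec_det2 \<psi>))"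
    by (simp only: sum_list_const_mult sum_list_product_lists mult.assoc)
  also have "(\<Prod>B\<leftarrow>G 0 # ?As. frob B / 2) = (\<Prod>q\<le>N. frob (G q) / 2)"
    using prod.distinct_set_conv_list[of "[0..<Suc N]" "\<lambda>q. frob (G q) / 2"]
    unfolding list[symmetric] by (simp add: comp_def atLeast0LessThan lessThan_Suc_atMost del: upt_Suc)
  also have "(\<Prod>xs\<leftarrow>map \<Psi> [1..<Suc N]. \<Sum>\<psi>\<leftarrow>xs. cmod (vec_det2 \<psi>)) = (\<Prod>k=1..N. \<Sum>\<psi>\<leftarrow>\<Psi> k. cmod (vec_det2 \<psi>))"
    using prod.distinct_set_conv_list[of "[1..<Suc N]" "\<lambda>k. \<Sum>\<psi>\<leftarrow>\<Psi> k. cmod (vec_det2 \<psi>)"]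
    by (simp add: comp_def atLeastLessThanSuc_atLeastAtMost del: upt_Suc)
  finally show ?thesis .
qed

section \<open>Summation over all outcomes and the limit\<close>

lemma prod_qubit_dim:
  assumes "N \<ge> 1"
  shows "(\<Prod>q\<le>N. qubit_dim N q) = 4 ^ N"
proof -
  obtain n where N: "N = Suc n" using assms by (cases N) auto
  have "(\<Prod>q\<le>N. qubit_dim N q) = qubit_dim N 0 * (\<Prod>q<n. qubit_dim N (Suc q)) * qubit_dim N N"
    by (simp only: N lessThan_Suc_atMost[symmetric] prod.lessThan_Suc[of _ "Suc n"]
        prod.lessThan_Suc_shift[of _ n])
  also have "(\<Prod>q<n. qubit_dim N (Suc q)) = (\<Prod>q<n. 4)"
    by (rule prod.cong) (auto simp: qubit_dim_def N)
  finally show ?thesis by (simp add: qubit_dim_def N)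
qed

lemma distribution_concurrence_le:
  assumes "N \<ge> 1" "locc_protocol N Q" "\<And>k. k \<in> {1..N} \<Longrightarrow> rank1_decomposition 4 (\<rho> k) (\<Psi> k)"
  shows "(\<Sum>(P, \<sigma>)\<leftarrow>locc_distribution N (chain_state N \<rho>) Q. P * concurrence \<sigma>)
    \<le> (\<Prod>k=1..N. \<Sum>\<psi>\<leftarrow>\<Psi> k. 2 * cmod (vec_det2 \<psi>))"
proof -
  let ?F = "\<lambda>q. 1\<^sub>m (qubit_dim N q) :: complex mat" and ?X = "chain_state N \<rho>"
  let ?K = "\<lambda>F. kron_list (map F [0..<Suc N])"
  let ?B = "\<lambda>G. ?K G * ?X * mat_adjoint (?K G)"
  let ?w = "\<Prod>k=1..N. \<Sum>\<psi>\<leftarrow>\<Psi> k. cmod (vec_det2 \<psi>)"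
  have valid: "valid_locc N (qubit_dim N) Q" using assms(2) by (simp add: locc_protocol_def)
  have "prod_list (map (qubit_dim N) [0..<Suc N]) = 4 ^ N"
    using prod_qubit_dim[OF assms(1)] prod.distinct_set_conv_list[of "[0..<Suc N]" "qubit_dim N"]
    by (simp add: atLeast0LessThan lessThan_Suc_atMost del: upt_Suc)
  then have KF: "?K ?F = 1\<^sub>m (4 ^ N)"
    by (simp add: kron_list_one del: upt_Suc)
  have X: "?X \<in> carrier_mat (4 ^ N) (4 ^ N)"
    using rank1_kron_list[of "[1..<Suc N]" \<rho> \<Psi>] assms(3)
    by (simp add: chain_state_def kron_list_def rank1_decomposition_def del: upt_Suc)
  have "mat_adjoint (1\<^sub>m n) = (1\<^sub>m n :: complex mat)" for n
    by (rule eq_matI) auto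
  \<comment> \<open>The protocol starts from the family of identities, which brings its outcomes
    into the form of \<open>locc_outcomes_eq\<close>.\<close>
  then have "?B ?F = ?X" unfolding KF using X by simp
  with locc_outcomes_eq[OF valid, of ?F "4 ^ N" ?X] KF X
  have outcomes: "locc_outcomes N (qubit_dim N) ?X Q = map ?B (locc_kraus ?F Q)"
    by (simp del: upt_Suc)
  have step: "Re (mat_trace B) * concurrence ((1 / mat_trace B) \<cdot>\<^sub>m partial_trace 2 (dim_row B div 4) 2 B)
      \<le> (\<Prod>q\<le>N. frob (G q)) * (2 * ?w / 2 ^ Suc N)"
    if G: "G \<in> set (locc_kraus ?F Q)" and B: "B = ?B G" for G B
  proof -
    have "dim_col (G q) = qubit_dim N q \<and> even (dim_row (G q))" if "q \<le> N" for q
      using locc_kraus_carrier[OF valid, of ?F "qubit_dim N" G q] G that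
      by (fastforce simp: qubit_dim_def)
    from kraus_outcome_concurrence_le[OF assms(1) this assms(3) B] show ?thesis
      by (simp add: prod_dividef mult_ac)
  qed
  have "(\<Sum>(P, \<sigma>)\<leftarrow>locc_distribution N ?X Q. P * concurrence \<sigma>)
      \<le> (\<Sum>G\<leftarrow>locc_kraus ?F Q. (\<Prod>q\<le>N. frob (G q)) * (2 * ?w / 2 ^ Suc N))"
    unfolding locc_distribution_def outcomes map_map comp_def prod.case
    by (rule sum_list_mono) (rule step, assumption, rule refl)
  also have "\<dots> = (\<Prod>q\<le>N. frob (?F q)) * (2 * ?w / 2 ^ Suc N)"
    unfolding sum_list_mult_const by (subst sum_list_locc_kraus[OF valid]) simp_all
  also have "(\<Prod>q\<le>N. frob (?F q)) = 4 ^ N"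
    using prod_qubit_dim[OF assms(1)] by (simp add: frob_one flip: of_nat_prod)
  \<comment> \<open>The remaining \<open>2 ^ N\<close> supplies each of the N links with the factor
    2 of its concurrence.\<close>
  also have "4 ^ N * (2 * ?w / 2 ^ Suc N) = 2 ^ N * ?w"
  proof -
    have "(4::real) ^ N = 2 ^ N * 2 ^ N" by (simp flip: power_mult_distrib)
    then show ?thesis by simp
  qed
  also have "\<dots> = (\<Prod>k=1..N. \<Sum>\<psi>\<leftarrow>\<Psi> k. 2 * cmod (vec_det2 \<psi>))"
    by (simp add: sum_list_const_mult prod.distrib)
  finally show ?thesis .
qed

theorem corollary1:
  fixes N :: nat and \<rho> :: "nat \<Rightarrow> complex mat" and Q :: locc
  assumes "N \<ge> 1"
    and "\<And>k. k \<in> {1..N} \<Longrightarrow> density_operator 4 (\<rho> k)"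
    and "locc_protocol N Q"
  shows "(\<Sum>(P, \<sigma>)\<leftarrow>locc_distribution N (chain_state N \<rho>) Q. P * concurrence \<sigma>)
    \<le> (\<Prod>k = 1..N. concurrence (\<rho> k))"
\<comment> \<open>The bound is shown with every concurrence enlarged by \<epsilon> > 0; the finite
  product is continuous in \<epsilon>.\<close>
proof (rule tendsto_lowerbound)
  show "((\<lambda>\<epsilon>. \<Prod>k = 1..N. concurrence (\<rho> k) + \<epsilon>) \<longlongrightarrow> (\<Prod>k = 1..N. concurrence (\<rho> k))) (at_right 0)"
    by (auto intro!: tendsto_eq_intros)
  have "(\<Sum>(P, \<sigma>)\<leftarrow>locc_distribution N (chain_state N \<rho>) Q. P * concurrence \<sigma>)
      \<le> (\<Prod>k = 1..N. concurrence (\<rho> k) + \<epsilon>)" if "\<epsilon> > 0" for \<epsilon>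
  proof -
    have "\<forall>k\<in>{1..N}. \<exists>\<psi>s. rank1_decomposition 4 (\<rho> k) \<psi>s \<and>
        (\<Sum>\<psi>\<leftarrow>\<psi>s. 2 * cmod (vec_det2 \<psi>)) \<le> concurrence (\<rho> k) + \<epsilon>"
      using concurrence_approx[OF assms(2) that] by blast
    then obtain \<Psi> where \<Psi>: "\<And>k. k \<in> {1..N} \<Longrightarrow> rank1_decomposition 4 (\<rho> k) (\<Psi> k)"
      "\<And>k. k \<in> {1..N} \<Longrightarrow> (\<Sum>\<psi>\<leftarrow>\<Psi> k. 2 * cmod (vec_det2 \<psi>)) \<le> concurrence (\<rho> k) + \<epsilon>"
      by metis
    have "(\<Sum>(P, \<sigma>)\<leftarrow>locc_distribution N (chain_state N \<rho>) Q. P * concurrence \<sigma>)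
        \<le> (\<Prod>k=1..N. \<Sum>\<psi>\<leftarrow>\<Psi> k. 2 * cmod (vec_det2 \<psi>))"
      using assms(1,3) \<Psi>(1) by (rule distribution_concurrence_le)
    also have "\<dots> \<le> (\<Prod>k = 1..N. concurrence (\<rho> k) + \<epsilon>)"
      using \<Psi>(2) by (intro prod_mono conjI sum_list_nonneg) auto
    finally show ?thesis .
  qed
  then show "\<forall>\<^sub>F \<epsilon> in at_right 0. (\<Sum>(P, \<sigma>)\<leftarrow>locc_distribution N (chain_state N \<rho>) Q. P * concurrence \<sigma>)
      \<le> (\<Prod>k = 1..N. concurrence (\<rho> k) + \<epsilon>)"
    by (auto simp: eventually_at_right_field intro: exI[of _ 1])
qed simp

end
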